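(* Let $k,n$ be integers with $1\le k<n$. Then the monomial $$z_k=x_1\cdots x_k\; y_1^{2^{k}-2^{k-1}-1}\,y_2^{2^k-2^{k-2}-1}\cdots y_k^{2^k-2^0-1}\; y_{k+1}^{2^k-1}\cdots y_n^{2^k-1}$$ of $M_n$ (that is, $x_1\cdots x_k\prod_{i=1}^k y_i^{2^k-2^{k-i}-1}\prod_{i=k+1}^n y_i^{2^k-1}$) is not in $\mathcal{A}^{*,*}_+(M_n)$.
   Context: The base field is $\mathbb{C}$. Let $$M_n=\mathbb{Z}/2[\tau,x_1,\dots,x_n,y_1,\dots,y_n]/(x_1^2+\tau y_1,\dots,x_n^2+\tau y_n),$$ bigraded by $\deg\tau=(0,1)$, $\deg x_i=(1,1)$, $\deg y_i=(2,1)$; this is the mod $2$ motivic cohomology of the classifying space of $(\mathbb{Z}/2)^n$. The mod $2$ motivic Steenrod algebra $\mathcal{A}^{*,*}$ contains $\mathbb{Z}/2[\tau]$ (acting on $M_n$ by multiplication) and is generated over it by $Q_0$ (of degree $(1,0)$) and $\wp^a$, $a\ge 1$ (of degree $(2a,a)$); $\wp^0$ is the identity. These operations act additively on $M_n$ by $Q_0(\tau)=0$, $\wp^a(\tau)=0$ for $a\ge1$; $Q_0(x_i)=y_i$, $\wp^a(x_i)=0$ for $a\ge 1$; $Q_0(y_i)=0$, $\wp^1(y_i)=y_i^2$, $\wp^a(y_i)=0$ for $a\ge2$; and the Cartan formulas $$Q_0(xy)=Q_0(x)y+xQ_0(y),\qquad \wp^a(xy)=\sum_{b=0}^a\wp^{a-b}(x)\wp^b(y)+\tau\sum_{b=0}^{a-1}Q_0\wp^{a-1-b}(x)\,Q_0\wp^b(y).$$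 $\mathcal{A}^{*,*}_+$ is the set of homogeneous elements of $\mathcal{A}^{*,*}$ whose first and second degrees have positive sum (so $\tau\in\mathcal{A}^{*,*}_+$), and $\mathcal{A}^{*,*}_+(M_n)$ is the $\mathbb{Z}/2$-subspace of $M_n$ spanned by all $ax$ with $a\in\mathcal{A}^{*,*}_+$, $x\in M_n$. *)

theory Defs
  imports
    "HOL-Library.Poly_Mapping"
    "HOL-Library.Product_Plus"
    "HOL-Library.Z2"
    "HOL-Computational_Algebra.Polynomial"
begin

section \<open>The ring \<open>M\<^sub>n\<close>\<close>

text \<open>The number \<open>n\<close> of pairs of variables is the cardinality of the index type \<open>'n\<close>;
  the type \<open>'n mpoly2\<close> is the polynomial ring over \<open>\<int>/2\<close>.\<close>

datatype 'n mvar = VTau | VX 'n | VY 'n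

type_synonym 'n mpoly2 = "('n mvar \<Rightarrow>\<^sub>0 nat) \<Rightarrow>\<^sub>0 bit"

definition var :: "'n mvar \<Rightarrow> 'n mpoly2" where
  "var v = Poly_Mapping.single (Poly_Mapping.single v 1) 1"

text \<open>The ideal generated by the \<open>x\<^sub>i\<^sup>2 + \<tau> y\<^sub>i\<close>: the span over the ring itself.\<close>

definition rel_ideal :: "'n mpoly2 set" where
  "rel_ideal = module.span (*) (range (\<lambda>i. var (VX i) ^ 2 + var VTau * var (VY i)))"

lemma module_times: "module ((*) :: 'a::comm_ring_1 \<Rightarrow> 'a \<Rightarrow> 'a)"
  by unfold_locales (simp_all add: algebra_simps)

lemma rel_ideal_zero: "0 \<in> rel_ideal"
  unfolding rel_ideal_def by (rule module.span_zero[OF module_times])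

lemma rel_ideal_add: "p \<in> rel_ideal \<Longrightarrow> q \<in> rel_ideal \<Longrightarrow> p + q \<in> rel_ideal"
  unfolding rel_ideal_def by (rule module.span_add[OF module_times])

lemma rel_ideal_uminus: "p \<in> rel_ideal \<Longrightarrow> - p \<in> rel_ideal"
  unfolding rel_ideal_def by (rule module.span_neg[OF module_times])

lemma rel_ideal_mult: "p \<in> rel_ideal \<Longrightarrow> c * p \<in> rel_ideal"
  unfolding rel_ideal_def by (rule module.span_scale[OF module_times])

lemma lookup_mult_zero:
  fixes p q :: "('v \<Rightarrow>\<^sub>0 nat) \<Rightarrow>\<^sub>0 'b::comm_ring_1"
  shows "Poly_Mapping.lookup (p * q) 0 = Poly_Mapping.lookup p 0 * Poly_Mapping.lookup q 0"
proof -
  have *: "(0 = l + m) \<longleftrightarrow> l = 0 \<and> m = 0" for l m :: "'v \<Rightarrow>\<^sub>0 nat"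
    by (auto simp: poly_mapping_eq_iff fun_eq_iff lookup_add)
  have **: "(\<Sum>m. Poly_Mapping.lookup q m when 0 = l + m) = (Poly_Mapping.lookup q 0 when l = 0)" for l
    unfolding * by (cases "l = 0") simp_all
  show ?thesis
    unfolding lookup_mult ** mult_when by simp
qed

lemma lookup_var_zero: "Poly_Mapping.lookup (var v) 0 = 0"
proof -
  have "Poly_Mapping.single v (1::nat) \<noteq> 0"
    by (metis lookup_single_eq lookup_zero zero_neq_one)
  then show ?thesis by (simp add: var_def lookup_single when_def)
qed

lemma one_notin_rel_ideal: "1 \<notin> (rel_ideal :: 'n mpoly2 set)"
proof
  let ?T = "{p :: 'n mpoly2. Poly_Mapping.lookup p 0 = 0}"
  have "module.subspace (*) ?T"
    unfolding module.subspace_def[OF module_times]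
    by (auto simp: lookup_add lookup_mult_zero)
  then have "rel_ideal \<subseteq> ?T"
    unfolding rel_ideal_def
    by (intro module.span_minimal[OF module_times])
       (auto simp: lookup_add lookup_mult_zero lookup_var_zero power2_eq_square)
  moreover assume "1 \<in> (rel_ideal :: 'n mpoly2 set)"
  ultimately have "Poly_Mapping.lookup (1 :: 'n mpoly2) 0 = 0" by blast
  then show False by (simp add: lookup_one)
qed

definition rel_cong :: "'n mpoly2 \<Rightarrow> 'n mpoly2 \<Rightarrow> bool" where
  "rel_cong p q \<longleftrightarrow> p - q \<in> rel_ideal"

lemma equivp_rel_cong: "equivp (rel_cong :: 'n mpoly2 \<Rightarrow> _)"
proof (rule equivpI)
  show "reflp (rel_cong :: 'n mpoly2 \<Rightarrow> _)"
    by (rule reflpI) (simp add: rel_cong_def rel_ideal_zero)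
  show "symp (rel_cong :: 'n mpoly2 \<Rightarrow> _)"
  proof (rule sympI)
    fix p q :: "'n mpoly2"
    assume "rel_cong p q"
    then have "- (p - q) \<in> rel_ideal"
      unfolding rel_cong_def by (rule rel_ideal_uminus)
    then show "rel_cong q p" by (simp add: rel_cong_def)
  qed
  show "transp (rel_cong :: 'n mpoly2 \<Rightarrow> _)"
  proof (rule transpI)
    fix p q r :: "'n mpoly2"
    assume "rel_cong p q" "rel_cong q r"
    then have "(p - q) + (q - r) \<in> rel_ideal"
      unfolding rel_cong_def by (rule rel_ideal_add)
    then show "rel_cong p r" by (simp add: rel_cong_def)
  qed
qed

quotient_type 'n motcoh = "'n mpoly2" / rel_cong
  by (rule equivp_rel_cong)

instantiation motcoh :: (type) comm_ring_1
begin

lift_definition zero_motcoh :: "'a motcoh" is 0 .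

lift_definition one_motcoh :: "'a motcoh" is 1 .

lift_definition plus_motcoh :: "'a motcoh \<Rightarrow> 'a motcoh \<Rightarrow> 'a motcoh" is "(+)"
proof -
  fix p p' q q' :: "'a mpoly2"
  assume "rel_cong p p'" "rel_cong q q'"
  then have "(p - p') + (q - q') \<in> rel_ideal"
    unfolding rel_cong_def by (rule rel_ideal_add)
  then show "rel_cong (p + q) (p' + q')"
    by (simp add: rel_cong_def algebra_simps)
qed

lift_definition uminus_motcoh :: "'a motcoh \<Rightarrow> 'a motcoh" is uminus
proof -
  fix p p' :: "'a mpoly2"
  assume "rel_cong p p'"
  then have "- (p - p') \<in> rel_ideal"
    unfolding rel_cong_def by (rule rel_ideal_uminus)
  then show "rel_cong (- p) (- p')"
    by (simp add: rel_cong_def algebra_simps)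
qed

lift_definition minus_motcoh :: "'a motcoh \<Rightarrow> 'a motcoh \<Rightarrow> 'a motcoh" is "(-)"
proof -
  fix p p' q q' :: "'a mpoly2"
  assume "rel_cong p p'" "rel_cong q q'"
  then have "(p - p') + - (q - q') \<in> rel_ideal"
    unfolding rel_cong_def by (intro rel_ideal_add rel_ideal_uminus)
  then show "rel_cong (p - q) (p' - q')"
    by (simp add: rel_cong_def algebra_simps)
qed

lift_definition times_motcoh :: "'a motcoh \<Rightarrow> 'a motcoh \<Rightarrow> 'a motcoh" is "(*)"
proof -
  fix p p' q q' :: "'a mpoly2"
  assume "rel_cong p p'" "rel_cong q q'"
  then have "q * (p - p') + p' * (q - q') \<in> rel_ideal"
    unfolding rel_cong_def by (intro rel_ideal_add rel_ideal_mult)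
  then show "rel_cong (p * q) (p' * q')"
    by (simp add: rel_cong_def algebra_simps)
qed

instance
proof
  fix a b c :: "'a motcoh"
  show "a * b * c = a * (b * c)"
    by transfer (simp add: rel_cong_def rel_ideal_zero algebra_simps)
  show "a * b = b * a"
    by transfer (simp add: rel_cong_def rel_ideal_zero algebra_simps)
  show "1 * a = a"
    by transfer (simp add: rel_cong_def rel_ideal_zero)
  show "(a + b) * c = a * c + b * c"
    by transfer (simp add: rel_cong_def rel_ideal_zero algebra_simps)
  show "a + b + c = a + (b + c)"
    by transfer (simp add: rel_cong_def rel_ideal_zero algebra_simps)
  show "a + b = b + a"
    by transfer (simp add: rel_cong_def rel_ideal_zero algebra_simps)
  show "0 + a = a"
    by transfer (simp add: rel_cong_def rel_ideal_zero)
  show "- a + a = 0"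
    by transfer (simp add: rel_cong_def rel_ideal_zero)
  show "a - b = a + - b"
    by transfer (simp add: rel_cong_def rel_ideal_zero)
  show "(0 :: 'a motcoh) \<noteq> 1"
  proof transfer
    show "\<not> rel_cong 0 (1 :: 'a mpoly2)"
      using rel_ideal_uminus[of "0 - 1 :: 'a mpoly2"] one_notin_rel_ideal
      by (auto simp: rel_cong_def)
  qed
qed

end

lift_definition mtau :: "'n motcoh" is "var VTau" .

lift_definition mx :: "'n \<Rightarrow> 'n motcoh" is "\<lambda>i. var (VX i)" .

lift_definition my :: "'n \<Rightarrow> 'n motcoh" is "\<lambda>i. var (VY i)" .

lemma mx_square: "mx i ^ 2 + mtau * my i = 0"
proof -
  have "var (VX i) * var (VX i) + var VTau * var (VY i) \<in> rel_ideal"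
    unfolding rel_ideal_def
    by (rule module.span_base[OF module_times]) (auto simp: power2_eq_square)
  then show ?thesis
    unfolding power2_eq_square by transfer (simp add: rel_cong_def)
qed

lemma motcoh_two: "(a :: 'n motcoh) + a = 0"
proof transfer
  fix p :: "'n mpoly2"
  have "b + b = 0" for b :: bit by (cases b) simp_all
  then have "p + p = 0"
    unfolding poly_mapping_eq_iff fun_eq_iff lookup_add by simp
  then show "rel_cong (p + p) 0"
    by (simp add: rel_cong_def rel_ideal_zero)
qed

definition mscale :: "bit \<Rightarrow> 'n motcoh \<Rightarrow> 'n motcoh" where
  "mscale c m = of_bit c * m"

lemma vector_space_mscale: "vector_space mscale"
proof
  fix c d :: bit and a b :: "'a motcoh"
  show "mscale c (a + b) = mscale c a + mscale c b"
    by (simp add: mscale_def algebra_simps)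
  show "mscale (c + d) a = mscale c a + mscale d a"
    by (cases c; cases d) (simp_all add: mscale_def motcoh_two)
  show "mscale c (mscale d a) = mscale (c * d) a"
    by (simp add: mscale_def)
  show "mscale 1 a = a"
    by (simp add: mscale_def)
qed


section \<open>The motivic Steenrod algebra and its action on \<open>M\<^sub>n\<close>\<close>

inductive_set subring_generated :: "'a::ring_1 set \<Rightarrow> 'a set" for S where
  incl: "a \<in> S \<Longrightarrow> a \<in> subring_generated S"
| one: "1 \<in> subring_generated S"
| diff: "a \<in> subring_generated S \<Longrightarrow> b \<in> subring_generated S \<Longrightarrow> a - b \<in> subring_generated S"
| mult: "a \<in> subring_generated S \<Longrightarrow> b \<in> subring_generated S \<Longrightarrow> a * b \<in> subring_generated S"

text \<open>\<open>gr (p, q)\<close> is the set of homogeneous elements of degree \<open>(p, q)\<close>, zero included.\<close>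

locale bigraded_ring =
  fixes gr :: "int \<times> int \<Rightarrow> 'a::ring_1 set"
  assumes gr_zero: "0 \<in> gr d"
    and gr_diff: "a \<in> gr d \<Longrightarrow> b \<in> gr d \<Longrightarrow> a - b \<in> gr d"
    and gr_one: "1 \<in> gr 0"
    and gr_mult: "a \<in> gr d \<Longrightarrow> b \<in> gr e \<Longrightarrow> a * b \<in> gr (d + e)"
    and gr_decomp:
      "\<exists>!f. finite {d. f d \<noteq> 0} \<and> (\<forall>d. f d \<in> gr d) \<and> a = (\<Sum>d | f d \<noteq> 0. f d)"

text \<open>A bigraded ring containing \<open>\<int>/2[\<tau>]\<close>, by means of the embedding \<open>emb\<close>, and
  generated over it by \<open>Q0\<close> and \<open>P r\<close> for \<open>r \<ge> 1\<close>.
  The motivic Steenrod algebra over the complex numbers is one such ring. Its other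
  relations (the Adem relations) are not assumed: they do not affect the subspace
  \<open>steenrod_plus_image\<close> below, since in any such ring the homogeneous
  elements of a given degree are the sums of words of that degree
  in \<open>\<tau>\<close>, \<open>Q0\<close> and the \<open>P r\<close>.\<close>

locale motivic_steenrod_algebra = bigraded_ring gr
  for gr :: "int \<times> int \<Rightarrow> 'a::ring_1 set" +
  fixes emb :: "bit poly \<Rightarrow> 'a" and Q0 :: 'a and P :: "nat \<Rightarrow> 'a"
  assumes emb_inj: "inj emb"
    and emb_one: "emb 1 = 1"
    and emb_add: "emb (f + g) = emb f + emb g"
    and emb_mult: "emb (f * g) = emb f * emb g"
    and tau_degree: "emb [:0, 1:] \<in> gr (0, 1)"
    and Q0_degree: "Q0 \<in> gr (1, 0)"
    and P_degree: "P r \<in> gr (2 * int r, int r)"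
    and P_zero: "P 0 = 1"
    and generated: "subring_generated (range emb \<union> {Q0} \<union> P ` {1..}) = UNIV"

locale motivic_steenrod_action = motivic_steenrod_algebra gr emb Q0 P
  for gr :: "int \<times> int \<Rightarrow> 'a::ring_1 set"
    and emb :: "bit poly \<Rightarrow> 'a" and Q0 :: 'a and P :: "nat \<Rightarrow> 'a" +
  fixes act :: "'a \<Rightarrow> 'n motcoh \<Rightarrow> 'n motcoh"
  assumes act_add_left: "act (a + b) u = act a u + act b u"
    and act_add_right: "act a (u + v) = act a u + act a v"
    and act_one: "act 1 u = u"
    and act_mult: "act (a * b) u = act a (act b u)"
    and act_tau: "act (emb [:0, 1:]) u = mtau * u"
    and Q0_tau: "act Q0 mtau = 0"
    and P_tau: "r \<ge> 1 \<Longrightarrow> act (P r) mtau = 0"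
    and Q0_x: "act Q0 (mx i) = my i"
    and P_x: "r \<ge> 1 \<Longrightarrow> act (P r) (mx i) = 0"
    and Q0_y: "act Q0 (my i) = 0"
    and P_one_y: "act (P 1) (my i) = my i ^ 2"
    and P_y: "r \<ge> 2 \<Longrightarrow> act (P r) (my i) = 0"
    and Q0_cartan: "act Q0 (u * v) = act Q0 u * v + u * act Q0 v"
    and P_cartan: "act (P r) (u * v) =
        (\<Sum>s\<in>{0..r}. act (P (r - s)) u * act (P s) v)
        + mtau * (\<Sum>s\<in>{0..<r}. act Q0 (act (P (r - 1 - s)) u) * act Q0 (act (P s) v))"

definition steenrod_plus :: "(int \<times> int \<Rightarrow> 'a::ring_1 set) \<Rightarrow> 'a set" where
  "steenrod_plus gr = {a. \<exists>p q. p + q > 0 \<and> a \<in> gr (p, q)}"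

definition steenrod_plus_image ::
  "(int \<times> int \<Rightarrow> 'a::ring_1 set) \<Rightarrow> ('a \<Rightarrow> 'n motcoh \<Rightarrow> 'n motcoh) \<Rightarrow> 'n motcoh set" where
  "steenrod_plus_image gr act = module.span mscale {act a u | a u. a \<in> steenrod_plus gr}"

text \<open>The monomial \<open>z\<^sub>k\<close>, where \<open>e\<close> enumerates the index type by \<open>1, \<dots>, n\<close>.
  For \<open>1 \<le> i \<le> k\<close> no truncation occurs in the exponents.\<close>

definition zmon :: "(nat \<Rightarrow> 'n) \<Rightarrow> nat \<Rightarrow> nat \<Rightarrow> 'n motcoh" where
  "zmon e n k = (\<Prod>i = 1..k. mx (e i)) * (\<Prod>i = 1..k. my (e i) ^ (2 ^ k - 2 ^ (k - i) - 1))
     * (\<Prod>i = k + 1..n. my (e i) ^ (2 ^ k - 1))"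

end

theory Submission
  imports
    Defs
    "HOL-Computational_Algebra.Formal_Power_Series"
    "HOL-Combinatorics.Transposition"
begin

text \<open>Let \<open>\<phi>\<close> be the linear form on \<open>M\<^sub>n\<close> that is \<open>1\<close> on the monomials obtained from \<open>z\<^sub>k\<close> by
  permuting the indices and \<open>0\<close> on all other monomials \<open>\<tau>\<^sup>c x\<^sub>S y\<^sup>m\<close>; it is the coefficient of
  \<open>\<Prod> y\<^sub>i\<close> to the power \<open>2\<^sup>k - 1\<close> in the result of applying the product of the first \<open>k\<close> Milnor
  operations modulo \<open>\<tau>\<close>. It vanishes on \<open>\<tau> M\<^sub>n\<close>, and it vanishes on the images of
  \<open>Q\<^sub>0\<close> and of \<open>\<wp>\<^sup>r\<close> for \<open>r \<ge> 1\<close> because the monomials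
  of \<open>Q\<^sub>0 u\<close> and \<open>\<wp>\<^sup>r u\<close> on which it is nonzero cancel in pairs. Hence it
  vanishes on \<open>A\<^sub>+(M\<^sub>n)\<close>, but not on \<open>z\<^sub>k\<close>.\<close>

section \<open>Binomial coefficients modulo 2 and the orbit of the exponents\<close>

text \<open>Lucas's theorem for the last binary digit: modulo 2, (1 + t)^(2m) equals (1 + t^2)^m.
  The induction applies Pascal's rule twice, which gives the middle term an even
  coefficient.\<close>

lemma choose_double_mod2:
  "even ((2 * m) choose (Suc (2 * a)))"
  "odd ((2 * m) choose (2 * a)) \<longleftrightarrow> odd (m choose a)"
proof -
  have "even ((2 * m) choose (Suc (2 * a))) \<and> (odd ((2 * m) choose (2 * a)) \<longleftrightarrow> odd (m choose a))" for a
  proof (induction m arbitrary: a)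
    case 0
    show ?case by (cases a) auto
  next
    case (Suc m)
    show ?case
    proof (cases a)
      case 0
      then show ?thesis by simp
    next
      case (Suc b)
      have "(2 * Suc m) choose (Suc (2 * a)) =
          ((2 * m) choose (Suc (2 * b))) + 2 * ((2 * m) choose (2 * a)) + ((2 * m) choose (Suc (2 * a)))"
        by (simp add: Suc)
      moreover have "(2 * Suc m) choose (2 * a) =
          ((2 * m) choose (2 * b)) + 2 * ((2 * m) choose (Suc (2 * b))) + ((2 * m) choose (2 * a))"
        by (simp add: Suc)
      moreover have "Suc m choose a = (m choose b) + (m choose a)"
        by (simp add: Suc)
      ultimately show ?thesis
        using Suc.IH[of a] Suc.IH[of b] by simp
    qed
  qed
  then show "even ((2 * m) choose (Suc (2 * a)))"
    and "odd ((2 * m) choose (2 * a)) \<longleftrightarrow> odd (m choose a)" by blast+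
qed

lemma choose_Suc_double_mod2:
  "odd (Suc (2 * m) choose (2 * a)) \<longleftrightarrow> odd (m choose a)"
  "odd (Suc (2 * m) choose (Suc (2 * a))) \<longleftrightarrow> odd (m choose a)"
proof -
  show "odd (Suc (2 * m) choose (2 * a)) \<longleftrightarrow> odd (m choose a)"
  proof (cases a)
    case 0
    then show ?thesis by simp
  next
    case (Suc b)
    have "Suc (2 * m) choose (2 * a) = ((2 * m) choose (Suc (2 * b))) + ((2 * m) choose (2 * a))"
      by (simp add: Suc)
    then show ?thesis using choose_double_mod2(1)[of m b] choose_double_mod2(2)[of m a] by simp
  qed
  have "Suc (2 * m) choose (Suc (2 * a)) = ((2 * m) choose (2 * a)) + ((2 * m) choose (Suc (2 * a)))"
    by simp
  then show "odd (Suc (2 * m) choose (Suc (2 * a))) \<longleftrightarrow> odd (m choose a)"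
    using choose_double_mod2[of m a] by simp
qed

text \<open>By Lucas, a binary digit 1 of \<open>a\<close> needs a digit 1 of \<open>m\<close> in
  the same place. Since \<open>m + a\<close> is odd for positive \<open>k\<close>, the last digit of
  \<open>a\<close> is 0 and that of \<open>m\<close> is 1; removing both leaves the same situation
  for \<open>k - 1\<close>.\<close>

lemma odd_choose_sum_eq_mersenne:
  assumes "odd (m choose a)" and "m + a + 1 = 2 ^ k"
  shows "a = 0"
  using assms
proof (induction k arbitrary: m a)
  case 0
  then show ?case by simp
next
  case (Suc k)
  have odd_sum: "odd (m + a)"
  proof -
    have "even (m + a + 1)" unfolding Suc.prems(2) by simp
    then show ?thesis by simp
  qed
  obtain a' where a': "a = 2 * a' \<or> a = Suc (2 * a')"
    by (metis evenE oddE Suc_eq_plus1)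
  obtain m' where m': "m = 2 * m' \<or> m = Suc (2 * m')"
    by (metis evenE oddE Suc_eq_plus1)
  have eq: "a = 2 * a'" "m = Suc (2 * m')"
  proof -
    have "\<not> (a = Suc (2 * a') \<and> m = 2 * m')"
      using Suc.prems(1) choose_double_mod2(1)[of m' a'] by blast
    moreover have "odd a \<longleftrightarrow> even m" using odd_sum by simp
    ultimately show "a = 2 * a'" "m = Suc (2 * m')" using a' m' by fastforce+
  qed
  have "odd (m' choose a')"
    using Suc.prems(1) unfolding eq choose_Suc_double_mod2 .
  moreover have "m' + a' + 1 = 2 ^ k"
    using Suc.prems(2) unfolding eq by simp
  ultimately have "a' = 0" by (rule Suc.IH)
  then show ?case using eq by simp
qed

text \<open>The conclusion says that \<open>m\<close> has exactly one digit 0 among its lowest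
  \<open>k\<close> binary digits. Again the last digits are removed. As long as \<open>j\<close> is
  positive they are 1 for \<open>m\<close> and 0 for \<open>a\<close>. At \<open>j = 0\<close> they
  agree: if both are 0, the previous lemma makes the rest of \<open>a\<close> vanish; if both are 1,
  the remaining digits satisfy the same equation with \<open>j = 0\<close>.\<close>

lemma odd_choose_sum_eq_mersenne_minus_power:
  assumes "odd (m choose a)" and "m + a + 1 + 2 ^ j = 2 ^ k"
  shows "\<exists>l<k. m + 1 + 2 ^ l = 2 ^ k"
  using assms
proof (induction k arbitrary: m a j)
  case 0
  then show ?case by simp
next
  case (Suc k)
  obtain a' where a': "a = 2 * a' \<or> a = Suc (2 * a')"
    by (metis evenE oddE Suc_eq_plus1)
  obtain m' where m': "m = 2 * m' \<or> m = Suc (2 * m')"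
    by (metis evenE oddE Suc_eq_plus1)
  \<comment> \<open>Putting the digit 1 back at the end of \<open>m'\<close> moves its only digit 0
    from place \<open>l\<close> to place \<open>Suc l\<close>.\<close>
  have lift: ?case if lift: "m = Suc (2 * m')" "odd (m' choose a')" "m' + a' + 1 + 2 ^ i = 2 ^ k" for i
  proof -
    obtain l where "l < k" "m' + 1 + 2 ^ l = 2 ^ k"
      using Suc.IH lift(2,3) by blast
    then show ?thesis using lift(1) by (intro exI[of _ "Suc l"]) auto
  qed
  show ?case
  proof (cases j)
    case 0
    have par: "even (m + a)"
    proof -
      have "even (m + a + 1 + 2 ^ j)" unfolding Suc.prems(2) by simp
      then show ?thesis using 0 by simp
    qed
    show ?thesis
    proof (cases "even a")
      case True
      then have eq: "a = 2 * a'" "m = 2 * m'"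
        using a' m' par by (simp; fastforce)+
      have odd': "odd (m' choose a')"
        using Suc.prems(1) unfolding eq choose_double_mod2 .
      have sum': "m' + a' + 1 = 2 ^ k"
        using Suc.prems(2) unfolding 0 eq by simp
      have "a' = 0" using odd' sum' by (rule odd_choose_sum_eq_mersenne)
      then show ?thesis using Suc.prems(2) unfolding 0 eq by (intro exI[of _ 0]) simp
    next
      case False
      then have eq: "a = Suc (2 * a')" "m = Suc (2 * m')"
        using a' m' par by (simp; fastforce)+
      have odd': "odd (m' choose a')"
        using Suc.prems(1) unfolding eq choose_Suc_double_mod2 .
      have sum': "m' + a' + 1 + 2 ^ 0 = 2 ^ k"
        using Suc.prems(2) unfolding 0 eq by simp
      show ?thesis using lift[OF eq(2) odd' sum'] .
    qed
  next
    case (Suc i)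
    have odd_sum: "odd (m + a)"
    proof -
      have "even (m + a + 1 + 2 ^ j)" unfolding Suc.prems(2) by simp
      then show ?thesis using Suc by simp
    qed
    have eq: "a = 2 * a'" "m = Suc (2 * m')"
    proof -
      have "\<not> (a = Suc (2 * a') \<and> m = 2 * m')"
        using Suc.prems(1) choose_double_mod2(1)[of m' a'] by blast
      moreover have "odd a \<longleftrightarrow> even m" using odd_sum by simp
      ultimately show "a = 2 * a'" "m = Suc (2 * m')" using a' m' by fastforce+
    qed
    have odd': "odd (m' choose a')"
      using Suc.prems(1) unfolding eq choose_Suc_double_mod2 .
    have sum': "m' + a' + 1 + 2 ^ i = 2 ^ k"
      using Suc.prems(2) unfolding Suc eq by simp
    show ?thesis using lift[OF eq(2) odd' sum'] .
  qed
qed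

text \<open>The pairs \<open>(S, m)\<close> for which \<open>x\<^sub>S y\<^sup>m\<close> is obtained from \<open>z\<^sub>k\<close> by a permutation of the
  indices.\<close>

definition zexp :: "nat \<Rightarrow> 'n set \<Rightarrow> ('n \<Rightarrow> nat) \<Rightarrow> bool" where
  "zexp k S m \<longleftrightarrow> (\<exists>\<sigma>. bij_betw \<sigma> S {..<k} \<and> (\<forall>i\<in>S. m i + 1 + 2 ^ \<sigma> i = 2 ^ k)
     \<and> (\<forall>i. i \<notin> S \<longrightarrow> m i + 1 = 2 ^ k))"

lemma zexp_transpose:
  assumes "zexp k S m"
  shows "zexp k (transpose i j ` S) (m \<circ> transpose i j)"
proof -
  obtain \<sigma> where \<sigma>: "bij_betw \<sigma> S {..<k}" "\<forall>i\<in>S. m i + 1 + 2 ^ \<sigma> i = 2 ^ k"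
    "\<forall>i. i \<notin> S \<longrightarrow> m i + 1 = 2 ^ k"
    using assms unfolding zexp_def by blast
  have "bij_betw (transpose i j) (transpose i j ` S) S"
    by (rule bij_betw_byWitness[where f' = "transpose i j"]) auto
  then have "bij_betw (\<sigma> \<circ> transpose i j) (transpose i j ` S) {..<k}"
    using \<sigma>(1) by (rule bij_betw_trans)
  moreover have "l \<in> transpose i j ` S \<longleftrightarrow> transpose i j l \<in> S" for l
    by (metis image_iff transpose_involutory)
  ultimately show ?thesis
    unfolding zexp_def using \<sigma>(2,3) by (intro exI[of _ "\<sigma> \<circ> transpose i j"]) auto
qed

lemma zexp_inj_on:
  assumes "zexp k S m"
  shows "inj_on m S"
proof -
  obtain \<sigma> where \<sigma>: "bij_betw \<sigma> S {..<k}" "\<forall>i\<in>S. m i + 1 + 2 ^ \<sigma> i = 2 ^ k"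
    using assms unfolding zexp_def by blast
  show ?thesis
  proof (rule inj_onI)
    fix i j assume "i \<in> S" "j \<in> S" "m i = m j"
    then have "(2::nat) ^ \<sigma> i = 2 ^ \<sigma> j" using \<sigma>(2) by (metis add_left_cancel)
    then show "i = j" using \<sigma>(1) \<open>i \<in> S\<close> \<open>j \<in> S\<close>
      by (auto simp: bij_betw_def inj_on_def)
  qed
qed

text \<open>The surviving terms come in pairs: besides \<open>s\<close>, the one index \<open>i\<close> with
  \<open>m i = 2\<^sup>k - 2\<close> contributes.\<close>

lemma sum_zexp_remove:
  assumes "1 \<le> k" and "finite S"
  shows "(\<Sum>s\<in>S. of_bool (zexp k (S - {s}) (m(s := m s + 1)))) = (0 :: bit)"
proof (cases "\<exists>s\<in>S. zexp k (S - {s}) (m(s := m s + 1))")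
  case False
  then show ?thesis by (intro sum.neutral) auto
next
  case True
  then obtain s where s: "s \<in> S" and z: "zexp k (S - {s}) (m(s := m s + 1))" by blast
  obtain \<sigma> where \<sigma>: "bij_betw \<sigma> (S - {s}) {..<k}"
    "\<forall>i\<in>S-{s}. (m(s := m s + 1)) i + 1 + 2 ^ \<sigma> i = 2 ^ k"
    "\<forall>i. i \<notin> S - {s} \<longrightarrow> (m(s := m s + 1)) i + 1 = 2 ^ k"
    using z unfolding zexp_def by blast
  \<comment> \<open>The smallest power, 2^0, is attained at some \<open>i\<close>, as
    \<open>k\<close> is positive. There the exponent is 2^k - 2, the same as \<open>m s\<close>
    before the increment, so exchanging \<open>s\<close> and \<open>i\<close> carries one term to
    the other.\<close>
  obtain i where i: "i \<in> S" "i \<noteq> s" "\<sigma> i = 0"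
  proof -
    have "0 \<in> \<sigma> ` (S - {s})" using \<sigma>(1) \<open>1 \<le> k\<close> by (simp add: bij_betw_def)
    then obtain i where "i \<in> S - {s}" "0 = \<sigma> i" by (rule imageE)
    then show ?thesis using that[of i] by auto
  qed
  have ms: "m s + 2 = 2 ^ k" using spec[OF \<sigma>(3), of s] by simp
  have mi: "m i + 2 = 2 ^ k" using bspec[OF \<sigma>(2), of i] i by simp
  have "transpose s i ` (S - {s}) = S - {i}"
    using s i(1,2) by (auto simp: image_iff transpose_def)
  moreover have "m(s := m s + 1) \<circ> transpose s i = m(i := m i + 1)"
    using ms mi by (auto simp: fun_eq_iff transpose_def)
  ultimately have zi: "zexp k (S - {i}) (m(i := m i + 1))"
    using zexp_transpose[OF z, of s i] by simp
  \<comment> \<open>For a third index \<open>j\<close>, both \<open>s\<close> and \<open>i\<close>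
    stay in the set with equal exponents, against injectivity.\<close>
  have other: "\<not> zexp k (S - {j}) (m(j := m j + 1))" if "j \<noteq> s" "j \<noteq> i" for j
  proof
    assume "zexp k (S - {j}) (m(j := m j + 1))"
    then have "inj_on (m(j := m j + 1)) (S - {j})" by (rule zexp_inj_on)
    then show False using that s i ms mi by (auto simp: inj_on_def)
  qed
  have "(\<Sum>s\<in>S. of_bool (zexp k (S - {s}) (m(s := m s + 1)))) =
    (\<Sum>s\<in>{s, i}. of_bool (zexp k (S - {s}) (m(s := m s + 1))) :: bit)"
    using s i other \<open>finite S\<close> by (intro sum.mono_neutral_right) auto
  also have "\<dots> = 0" using i(2) z zi by simp
  finally show ?thesis .
qed

section \<open>Cancellation in the binomial sums that arise from \<wp>^r\<close>

text \<open>The map \<open>g\<close> exchanges the two statistics \<open>r\<close> and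
  \<open>t\<close>, so it matches the part where \<open>t\<close> is smaller with the part where
  \<open>r\<close> is smaller. The two equal sums cancel in characteristic 2, and the diagonal
  contributes nothing.\<close>

lemma sum_bit_swap_zero:
  fixes h :: "'b \<Rightarrow> bit" and r :: "'b \<Rightarrow> nat"
  assumes "finite A" and "bij_betw g A A"
    and "\<And>x. x \<in> A \<Longrightarrow> h (g x) = h x"
    and "\<And>x. x \<in> A \<Longrightarrow> r (g x) = t x" "\<And>x. x \<in> A \<Longrightarrow> t (g x) = r x"
    and "\<And>x. x \<in> A \<Longrightarrow> r x = t x \<Longrightarrow> h x = 0"
  shows "sum h A = 0"
proof -
  have "sum h {x\<in>A. t x < r x} = sum h {x\<in>A. r x < t x}"
  proof -
    have "g ` {x\<in>A. t x < r x} = {x\<in>A. r x < t x}"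
    proof safe
      fix x assume "x \<in> A" "r x < t x"
      moreover obtain y where "y \<in> A" "x = g y"
        using assms(2) \<open>x \<in> A\<close> by (auto simp: bij_betw_def)
      ultimately show "x \<in> g ` {x \<in> A. t x < r x}" using assms(4,5) by auto
    qed (use assms(2,4,5) in \<open>auto simp: bij_betw_def\<close>)
    then have "bij_betw g {x\<in>A. t x < r x} {x\<in>A. r x < t x}"
      using assms(2) by (auto simp: bij_betw_def intro: inj_on_subset)
    then have "(\<Sum>x\<in>{x\<in>A. t x < r x}. h (g x)) = sum h {x\<in>A. r x < t x}"
      by (rule sum.reindex_bij_betw)
    then show ?thesis using assms(3) by simp
  qed
  moreover have "sum h A = sum h ({x\<in>A. t x < r x} \<union> {x\<in>A. r x < t x})"
  proof (rule sum.mono_neutral_right)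
    show "\<forall>x\<in>A - ({x\<in>A. t x < r x} \<union> {x\<in>A. r x < t x}). h x = 0"
      using assms(6) by (metis (mono_tags, lifting) DiffD1 DiffD2 UnI1 UnI2 linorder_neqE_nat mem_Collect_eq)
  qed (use assms(1) in auto)
  moreover have "\<dots> = sum h {x\<in>A. t x < r x} + sum h {x\<in>A. r x < t x}"
    using assms(1) by (intro sum.union_disjoint) auto
  ultimately show ?thesis by simp
qed

lemma of_nat_bit: "(of_nat n :: bit) = of_bool (odd n)"
  by (induction n) auto

text \<open>If \<open>m i = m j\<close> for distinct \<open>i, j\<close> in \<open>S\<close>, exchanging \<open>\<alpha> i\<close> and \<open>\<alpha> j\<close> pairs up the
  terms. Otherwise \<open>m\<close> itself has, on \<open>S\<close>, the values \<open>2\<^sup>k - 1 - 2\<^sup>l\<close> for \<open>l < k\<close>, and comparing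
  total degrees forces \<open>\<alpha> = 0\<close>.\<close>

lemma sum_choose_zexp:
  fixes m :: "'n \<Rightarrow> nat" and k a :: nat and S :: "'n set"
  assumes fin: "finite (UNIV :: 'n set)" and "1 \<le> a"
  shows "(\<Sum>\<alpha> | \<alpha> \<in> (\<Pi>\<^sub>E i\<in>UNIV. {..m i}) \<and> sum \<alpha> UNIV = a.
    of_nat (\<Prod>i\<in>UNIV. m i choose \<alpha> i) * of_bool (zexp k S (\<lambda>i. m i + \<alpha> i))) = (0 :: bit)"
    (is "sum ?h ?A = 0")
proof (cases "inj_on m S")
  case False
  then obtain i j where ij: "i \<in> S" "j \<in> S" "i \<noteq> j" "m i = m j" by (auto simp: inj_on_def)
  have m_transpose: "m (transpose i j l) = m l" for l using ij by (simp add: transpose_def)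
  have A: "\<alpha> \<in> ?A \<longleftrightarrow> (\<forall>i. \<alpha> i \<le> m i) \<and> sum \<alpha> UNIV = a" for \<alpha>
    by (auto simp: PiE_iff)
  have sum_transpose: "sum (\<alpha> \<circ> transpose i j) UNIV = sum \<alpha> UNIV" for \<alpha> :: "'n \<Rightarrow> nat"
    unfolding comp_def by (rule sum.reindex_bij_betw) simp
  have gA: "\<alpha> \<circ> transpose i j \<in> ?A" if "\<alpha> \<in> ?A" for \<alpha>
  proof -
    have "(\<alpha> \<circ> transpose i j) l \<le> m l" for l
      using that m_transpose[of l] unfolding A by (metis comp_apply)
    then show ?thesis using that unfolding A sum_transpose by blast
  qed
  have hom: "?h (\<alpha> \<circ> transpose i j) = ?h \<alpha>" for \<alpha>
  proof -
    have "(\<Prod>l\<in>UNIV. m l choose (\<alpha> \<circ> transpose i j) l) =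
        (\<Prod>l\<in>UNIV. (\<lambda>l. m l choose \<alpha> l) (transpose i j l))"
      by (simp add: m_transpose)
    also have "\<dots> = (\<Prod>l\<in>UNIV. m l choose \<alpha> l)"
      by (rule prod.reindex_bij_betw) simp
    finally have p: "(\<Prod>l\<in>UNIV. m l choose (\<alpha> \<circ> transpose i j) l) = (\<Prod>l\<in>UNIV. m l choose \<alpha> l)" .
    have S: "transpose i j ` S = S" using ij by simp
    have "zexp k S (\<lambda>i. m i + \<beta> i) \<Longrightarrow> zexp k S (\<lambda>l. m l + (\<beta> \<circ> transpose i j) l)" for \<beta>
      using zexp_transpose[of k S "\<lambda>i. m i + \<beta> i" i j] S by (simp add: comp_def m_transpose)
    from this[of \<alpha>] this[of "\<alpha> \<circ> transpose i j"]
    have "zexp k S (\<lambda>l. m l + (\<alpha> \<circ> transpose i j) l) \<longleftrightarrow> zexp k S (\<lambda>i. m i + \<alpha> i)"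
      by (auto simp: comp_def)
    then show ?thesis unfolding p by simp
  qed
  show ?thesis
  proof (rule sum_bit_swap_zero[where g = "\<lambda>\<alpha>. \<alpha> \<circ> transpose i j" and r = "\<lambda>\<alpha>. \<alpha> i" and t = "\<lambda>\<alpha>. \<alpha> j"])
    show "finite ?A" using finite_PiE[OF fin, of "\<lambda>i. {..m i}"] by simp
    show "bij_betw (\<lambda>\<alpha>. \<alpha> \<circ> transpose i j) ?A ?A"
      by (rule bij_betw_byWitness[where f' = "\<lambda>\<alpha>. \<alpha> \<circ> transpose i j"])
        (use gA in \<open>auto simp: comp_def\<close>)
    \<comment> \<open>On the diagonal the indices \<open>i\<close> and \<open>j\<close> of
      \<open>S\<close> would have equal exponents, which \<open>zexp_inj_on\<close>
      excludes.\<close>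
    show "?h \<alpha> = 0" if "\<alpha> i = \<alpha> j" for \<alpha>
      using zexp_inj_on[of k S "\<lambda>i. m i + \<alpha> i"] ij that by (auto simp: inj_on_def)
  qed (use hom in auto)
next
  case True
  show ?thesis
  proof (rule sum.neutral, rule ballI, rule ccontr)
    fix \<alpha> assume \<alpha>: "\<alpha> \<in> ?A" "?h \<alpha> \<noteq> 0"
    have "odd (\<Prod>i\<in>UNIV. m i choose \<alpha> i)"
      using \<alpha>(2) by (simp only: of_nat_bit mult_eq_0_iff of_bool_eq_0_iff de_Morgan_disj simp_thms)
    then have odd: "odd (m i choose \<alpha> i)" for i
      using dvd_prodI[OF fin UNIV_I, of "\<lambda>i. m i choose \<alpha> i" i] dvd_trans by blast
    have "zexp k S (\<lambda>i. m i + \<alpha> i)"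
      using \<alpha>(2) by (simp only: mult_eq_0_iff of_bool_eq_0_iff de_Morgan_disj simp_thms)
    then obtain \<sigma> where \<sigma>: "bij_betw \<sigma> S {..<k}" "\<forall>i\<in>S. m i + \<alpha> i + 1 + 2 ^ \<sigma> i = 2 ^ k"
        "\<forall>i. i \<notin> S \<longrightarrow> m i + \<alpha> i + 1 = 2 ^ k"
      unfolding zexp_def by blast
    have out: "\<alpha> i = 0" if "i \<notin> S" for i
      using odd_choose_sum_eq_mersenne[OF odd] \<sigma>(3) that by blast
    have "\<forall>i\<in>S. \<exists>l<k. m i + 1 + 2 ^ l = 2 ^ k"
      using odd_choose_sum_eq_mersenne_minus_power[OF odd] \<sigma>(2) by blast
    then obtain \<rho> where \<rho>: "\<And>i. i \<in> S \<Longrightarrow> \<rho> i < k" "\<And>i. i \<in> S \<Longrightarrow> m i + 1 + 2 ^ \<rho> i = 2 ^ k"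
      by metis
    \<comment> \<open>Injectivity of \<open>m\<close> passes to \<open>\<rho>\<close>, so
      \<open>\<rho>\<close> and \<open>\<sigma>\<close> both enumerate \<open>{..<k}\<close>, and
      their powers of 2 have the same sum. On \<open>S\<close> these powers differ by \<alpha>,
      whose sum is therefore 0.\<close>
    have "inj_on \<rho> S"
      using True \<rho>(2) by (metis (no_types, lifting) inj_on_def add_right_cancel)
    moreover have "card S = k" using bij_betw_same_card[OF \<sigma>(1)] by simp
    ultimately have "bij_betw \<rho> S {..<k}"
      using \<rho>(1) by (intro bij_betw_imageI card_subset_eq) (auto simp: card_image)
    then have "(\<Sum>i\<in>S. (2::nat) ^ \<rho> i) = (\<Sum>l<k. 2 ^ l)" by (rule sum.reindex_bij_betw)
    moreover have "(\<Sum>i\<in>S. (2::nat) ^ \<sigma> i) = (\<Sum>l<k. 2 ^ l)"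
      using \<sigma>(1) by (rule sum.reindex_bij_betw)
    moreover have "(\<Sum>i\<in>S. (2::nat) ^ \<rho> i) = (\<Sum>i\<in>S. \<alpha> i + 2 ^ \<sigma> i)"
    proof (rule sum.cong)
      fix i assume "i \<in> S"
      then show "(2::nat) ^ \<rho> i = \<alpha> i + 2 ^ \<sigma> i" using \<rho>(2)[of i] \<sigma>(2) by fastforce
    qed simp
    ultimately have "sum \<alpha> S = 0" by (simp add: sum.distrib)
    moreover have "sum \<alpha> UNIV = sum \<alpha> S"
      using fin out by (intro sum.mono_neutral_right) auto
    ultimately show False using \<alpha>(1) \<open>1 \<le> a\<close> by simp
  qed
qed

section \<open>Homogeneous elements of positive degree\<close>

context motivic_steenrod_algebra
begin

text \<open>Every element is a sum of \<open>1\<close> (or \<open>0\<close>) and nonempty words in the generators; words are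
  homogeneous, so by uniqueness of the decomposition a homogeneous element of positive
  degree is a sum of nonempty words.\<close>

lemma steenrod_plus_subset_right_ideal:
  assumes T_zero: "0 \<in> T" and T_diff: "\<And>a b. a \<in> T \<Longrightarrow> b \<in> T \<Longrightarrow> a - b \<in> T"
    and T_mult: "\<And>a b. a \<in> T \<Longrightarrow> a * b \<in> T"
    and T_gens: "emb [:0, 1:] \<in> T" "Q0 \<in> T" "\<And>r. 1 \<le> r \<Longrightarrow> P r \<in> T"
  shows "steenrod_plus gr \<subseteq> T"
proof
  \<comment> \<open>The unit together with the elements of \<open>T\<close> that are homogeneous of
    positive total degree. This set is closed under products and contains all generators except
    constants.\<close>
  define E where "E = insert 1 {w \<in> T. w \<in> steenrod_plus gr}"
  \<comment> \<open>\<open>W a\<close> says that \<open>a\<close> has a homogeneous decomposition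
    whose pieces of positive total degree lie in \<open>T\<close>. Nothing is required in degree 0,
    where the unit sits.\<close>
  define W where "W = (\<lambda>a. \<exists>D f. finite D \<and> (\<forall>d. f d \<in> gr d) \<and> (\<forall>d. d \<notin> D \<longrightarrow> f d = 0) \<and>
    a = (\<Sum>d\<in>D. f d) \<and> (\<forall>p q. p + q > 0 \<longrightarrow> f (p, q) \<in> T))"
  have W_E: "W w" if "w \<in> E" for w
  proof -
    obtain d where d: "w \<in> gr d" "fst d + snd d > 0 \<longrightarrow> w \<in> T"
    proof (cases "w = 1")
      case True
      then show ?thesis using that[of 0] gr_one by simp
    next
      case False
      then show ?thesis using \<open>w \<in> E\<close> that unfolding E_def steenrod_plus_def by force
    qed
    then show ?thesis
      unfolding W_def using gr_zero T_zero
      by (intro exI[of _ "{d}"] exI[of _ "\<lambda>e. if e = d then w else 0"]) auto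
  qed
  have W_diff: "W (a - b)" if "W a" "W b" for a b
  proof -
    obtain D f where f: "finite D" "\<forall>d. f d \<in> gr d" "\<forall>d. d \<notin> D \<longrightarrow> f d = 0"
      "a = (\<Sum>d\<in>D. f d)" "\<forall>p q. p + q > 0 \<longrightarrow> f (p, q) \<in> T"
      using \<open>W a\<close> unfolding W_def by blast
    obtain D' g where g: "finite D'" "\<forall>d. g d \<in> gr d" "\<forall>d. d \<notin> D' \<longrightarrow> g d = 0"
      "b = (\<Sum>d\<in>D'. g d)" "\<forall>p q. p + q > 0 \<longrightarrow> g (p, q) \<in> T"
      using \<open>W b\<close> unfolding W_def by blast
    have "a = (\<Sum>d\<in>D \<union> D'. f d)" "b = (\<Sum>d\<in>D \<union> D'. g d)"
      unfolding f(4) g(4) using f g by (auto intro!: sum.mono_neutral_left)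
    then have "a - b = (\<Sum>d\<in>D \<union> D'. f d - g d)" by (simp add: sum_subtractf)
    then show ?thesis
      unfolding W_def using f g gr_diff T_diff
      by (intro exI[of _ "D \<union> D'"] exI[of _ "\<lambda>d. f d - g d"]) auto
  qed
  have W_zero: "W 0" using W_diff[OF W_E W_E, of 1 1] by (simp add: E_def)
  have E_mult: "v * w \<in> E" if "v \<in> E" "w \<in> E" for v w
  proof (cases "v = 1 \<or> w = 1")
    case True
    then show ?thesis using that by auto
  next
    case False
    have "v \<in> T" "v \<in> steenrod_plus gr" "w \<in> steenrod_plus gr"
      using False that unfolding E_def by blast+
    then obtain p q p' q' where v: "v \<in> T" "v \<in> gr (p, q)" "p + q > 0"
        and w: "w \<in> gr (p', q')" "p' + q' > 0"
      unfolding steenrod_plus_def by blast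
    have "v * w \<in> gr (p + p', q + q')" using gr_mult[OF v(2) w(1)] by simp
    moreover have "(p + p') + (q + q') > 0" using v(3) w(2) by simp
    ultimately show ?thesis
      unfolding E_def steenrod_plus_def using T_mult[OF v(1)] by blast
  qed
  \<comment> \<open>The additive subgroup spanned by \<open>E\<close>. Being closed under products
    it is a subring; it contains the generators, hence everything, and each of its elements
    satisfies \<open>W\<close>.\<close>
  define U where "U = \<Inter>{G. E \<subseteq> G \<and> (\<forall>a\<in>G. \<forall>b\<in>G. a - b \<in> G)}"
  have U_E: "w \<in> U" if "w \<in> E" for w using that unfolding U_def by blast
  have U_diff: "a - b \<in> U" if "a \<in> U" "b \<in> U" for a b using that unfolding U_def by blast
  have U_least: "U \<subseteq> G" if "E \<subseteq> G" "\<And>a b. a \<in> G \<Longrightarrow> b \<in> G \<Longrightarrow> a - b \<in> G" for G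
    using that unfolding U_def by blast
  have U_zero: "0 \<in> U" using U_diff[OF U_E U_E, of 1 1] by (simp add: E_def)
  have U_add: "a + b \<in> U" if "a \<in> U" "b \<in> U" for a b
    using U_diff[OF that(1) U_diff[OF U_zero that(2)]] by simp
  have "U \<subseteq> {a. \<forall>b\<in>U. a * b \<in> U}"
  proof (rule U_least)
    show "E \<subseteq> {a. \<forall>b\<in>U. a * b \<in> U}"
    proof safe
      fix v b assume "v \<in> E" "b \<in> U"
      have "U \<subseteq> {b. v * b \<in> U}"
        using E_mult[OF \<open>v \<in> E\<close>] by (intro U_least) (auto simp: right_diff_distrib intro: U_E U_diff)
      then show "v * b \<in> U" using \<open>b \<in> U\<close> by blast
    qed
  qed (auto simp: left_diff_distrib intro: U_diff)
  then have U_mult: "a * b \<in> U" if "a \<in> U" "b \<in> U" for a b using that by blast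
  have "emb [:0, 1:] \<in> E" "Q0 \<in> E"
    unfolding E_def steenrod_plus_def using tau_degree Q0_degree T_gens(1,2) by force+
  moreover have "P r \<in> E" if "1 \<le> r" for r
  proof -
    have "2 * int r + int r > 0" using that by simp
    then show ?thesis unfolding E_def steenrod_plus_def using P_degree T_gens(3)[OF that] by blast
  qed
  ultimately have gens: "emb [:0, 1:] \<in> U" "Q0 \<in> U" "\<And>r. 1 \<le> r \<Longrightarrow> P r \<in> U"
    using U_E by auto
  have emb_zero: "emb 0 = 0" using emb_add[of 0 0] by simp
  have emb_U: "emb f \<in> U" for f
  proof (induction f rule: pCons_induct)
    case 0
    then show ?case using emb_zero U_zero by simp
  next
    case (pCons c f)
    have "pCons c f = [:c:] + [:0, 1:] * f" by simp
    then have "emb (pCons c f) = emb [:c:] + emb [:0, 1:] * emb f"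
      by (metis emb_add emb_mult)
    moreover have "emb [:c:] \<in> U"
    proof (cases c)
      case zero
      then show ?thesis using emb_zero U_zero by simp
    next
      case one
      then have "emb [:c:] = 1" using emb_one by (simp add: one_pCons)
      then show ?thesis using U_E[of 1] by (simp add: E_def)
    qed
    ultimately show ?case using U_add U_mult gens(1) pCons.IH by simp
  qed
  have "a \<in> subring_generated (range emb \<union> {Q0} \<union> P ` {1..}) \<Longrightarrow> a \<in> U" for a
    by (induction rule: subring_generated.induct)
      (use emb_U gens U_E U_diff U_mult in \<open>auto simp: E_def\<close>)
  moreover have "U \<subseteq> {a. W a}"
    using W_E W_diff by (intro U_least) auto
  ultimately have W: "W a" for a using generated by blast
  fix a assume "a \<in> steenrod_plus gr"
  then obtain p q where pq: "p + q > 0" "a \<in> gr (p, q)" unfolding steenrod_plus_def by blast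
  obtain D f where f: "finite D" "\<forall>d. f d \<in> gr d" "\<forall>d. d \<notin> D \<longrightarrow> f d = 0"
    "a = (\<Sum>d\<in>D. f d)" "\<forall>p q. p + q > 0 \<longrightarrow> f (p, q) \<in> T"
    using W[of a] unfolding W_def by blast
  \<comment> \<open>The decomposition of \<open>a\<close> concentrated in its own degree; uniqueness
    identifies it with \<open>f\<close>, whose piece in that degree lies in
    \<open>T\<close>.\<close>
  let ?g = "\<lambda>d. if d = (p, q) then a else 0"
  have sub: "{d. f d \<noteq> 0} \<subseteq> D" using f(3) by auto
  have F: "finite {d. f d \<noteq> 0} \<and> (\<forall>d. f d \<in> gr d) \<and> a = (\<Sum>d | f d \<noteq> 0. f d)"
    using f(1,2,4) sub by (auto intro: finite_subset sum.mono_neutral_right)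
  have G: "finite {d. ?g d \<noteq> 0} \<and> (\<forall>d. ?g d \<in> gr d) \<and> a = (\<Sum>d | ?g d \<noteq> 0. ?g d)"
  proof (intro conjI)
    have sub: "{d. ?g d \<noteq> 0} \<subseteq> {(p, q)}" by auto
    then show "finite {d. ?g d \<noteq> 0}" by (rule finite_subset) simp
    have "(\<Sum>d | ?g d \<noteq> 0. ?g d) = (\<Sum>d\<in>{(p, q)}. ?g d)"
      using sub by (intro sum.mono_neutral_left) auto
    then show "a = (\<Sum>d | ?g d \<noteq> 0. ?g d)" by simp
  qed (use pq gr_zero in auto)
  obtain h where
    h: "\<forall>y. finite {d. y d \<noteq> 0} \<and> (\<forall>d. y d \<in> gr d) \<and> a = (\<Sum>d | y d \<noteq> 0. y d) \<longrightarrow> y = h"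
    using gr_decomp[of a] by (elim ex1E) blast
  have "f = ?g"
    unfolding mp[OF spec[OF h] F] mp[OF spec[OF h] G] ..
  then have "f (p, q) = a" by simp
  then show "a \<in> T" using f(5) pq(1) by metis
qed

end

section \<open>Monomials and the dual linear form\<close>

definition mmon :: "'n set \<Rightarrow> ('n \<Rightarrow> nat) \<Rightarrow> 'n motcoh" where
  "mmon S m = (\<Prod>i\<in>S. mx i) * (\<Prod>i\<in>UNIV. my i ^ m i)"

definition mclass :: "('n mvar \<Rightarrow>\<^sub>0 nat) \<Rightarrow> 'n motcoh" where
  "mclass \<mu> = abs_motcoh (Poly_Mapping.single \<mu> 1)"

lemma mclass_zero: "mclass 0 = 1"
  by (simp add: mclass_def one_motcoh_def)

lemma mclass_add: "mclass (\<mu> + \<nu>) = mclass \<mu> * mclass \<nu>"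
  by (simp add: mclass_def times_motcoh.abs_eq mult_single)

lemma mclass_sum: "mclass (\<Sum>i\<in>A. f i) = (\<Prod>i\<in>A. mclass (f i))"
  by (induction A rule: infinite_finite_induct) (simp_all add: mclass_zero mclass_add)

lemma mclass_single_power: "mclass (Poly_Mapping.single v m) = mclass (Poly_Mapping.single v 1) ^ m"
proof (induction m)
  case 0
  then show ?case by (simp add: mclass_zero)
next
  case (Suc m)
  have "Poly_Mapping.single v (Suc m) = Poly_Mapping.single v 1 + Poly_Mapping.single v m"
    by (simp flip: single_add)
  then show ?case using Suc by (simp add: mclass_add)
qed

lemma mclass_var:
  "mclass (Poly_Mapping.single VTau 1) = mtau"
  "mclass (Poly_Mapping.single (VX i) 1) = mx i"
  "mclass (Poly_Mapping.single (VY i) 1) = my i"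
  by (simp_all add: mclass_def mtau_def mx_def my_def var_def)

definition mexp :: "'n set \<Rightarrow> ('n \<Rightarrow> nat) \<Rightarrow> 'n mvar \<Rightarrow>\<^sub>0 nat" where
  "mexp S m = (\<Sum>i\<in>S. Poly_Mapping.single (VX i) 1) + (\<Sum>i\<in>UNIV. Poly_Mapping.single (VY i) (m i))"

lemma mclass_mexp: "mclass (mexp S m) = mmon S m"
proof -
  have "mclass (Poly_Mapping.single (VY i) (m i)) = my i ^ m i" for i
    by (subst mclass_single_power) (simp only: mclass_var)
  then show ?thesis
    by (simp only: mexp_def mmon_def mclass_add mclass_sum mclass_var)
qed

lemma lookup_mexp:
  fixes m :: "'n \<Rightarrow> nat"
  assumes fin: "finite (UNIV :: 'n set)"
  shows "Poly_Mapping.lookup (mexp S m) VTau = 0"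
    and "Poly_Mapping.lookup (mexp S m) (VX i) = of_bool (i \<in> S)"
    and "Poly_Mapping.lookup (mexp S m) (VY i) = m i"
  using finite_subset[OF subset_UNIV fin, of S] fin
  by (simp_all add: mexp_def lookup_add lookup_sum lookup_single when_def sum.delta)

lemma mexp_eqI:
  fixes \<mu> :: "'n mvar \<Rightarrow>\<^sub>0 nat"
  assumes "finite (UNIV :: 'n set)" and "Poly_Mapping.lookup \<mu> VTau = 0"
    and "\<And>i. Poly_Mapping.lookup \<mu> (VX i) \<le> 1"
  shows "\<mu> = mexp {i. Poly_Mapping.lookup \<mu> (VX i) = 1} (\<lambda>i. Poly_Mapping.lookup \<mu> (VY i))"
proof (rule poly_mapping_eqI)
  fix v :: "'n mvar"
  show "Poly_Mapping.lookup \<mu> v = Poly_Mapping.lookup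
    (mexp {i. Poly_Mapping.lookup \<mu> (VX i) = 1} (\<lambda>i. Poly_Mapping.lookup \<mu> (VY i))) v"
  proof (cases v)
    case (VX i)
    then show ?thesis using assms(3)[of i] by (simp add: lookup_mexp[OF assms(1)])
  qed (simp_all add: lookup_mexp[OF assms(1)] assms(2))
qed

text \<open>A monomial free of \<tau> either is squarefree in the x_i, hence some
  \<open>mmon S m\<close>, or contains a square, and x_i^2 = \<tau> y_i makes it a multiple of
  \<tau>.\<close>

lemma mclass_cases:
  fixes \<mu> :: "'n mvar \<Rightarrow>\<^sub>0 nat"
  assumes fin: "finite (UNIV :: 'n set)"
  obtains u where "mclass \<mu> = mtau * u" | S m where "mclass \<mu> = mmon S m"
proof -
  have split: "mclass \<mu> = mclass (Poly_Mapping.single v c) * mclass (\<mu> - Poly_Mapping.single v c)"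
    if "c \<le> Poly_Mapping.lookup \<mu> v" for v c
  proof -
    have "\<mu> = Poly_Mapping.single v c + (\<mu> - Poly_Mapping.single v c)"
      using that by (intro poly_mapping_eqI) (auto simp: lookup_add lookup_minus lookup_single when_def)
    then show ?thesis by (metis mclass_add)
  qed
  consider "1 \<le> Poly_Mapping.lookup \<mu> VTau" | i where "2 \<le> Poly_Mapping.lookup \<mu> (VX i)"
    | "Poly_Mapping.lookup \<mu> VTau = 0" "\<And>i. Poly_Mapping.lookup \<mu> (VX i) \<le> 1"
    by (metis One_nat_def Suc_1 less_one not_less not_less_eq_eq)
  then show thesis
  proof cases
    case 1
    then show ?thesis using split[OF 1] that(1) unfolding mclass_var by blast
  next
    case 2
    have "mx i ^ 2 = mtau * my i"
      using mx_square[of i] motcoh_two[of "mtau * my i"] by (metis add_right_cancel)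
    then have "mclass \<mu> = mtau * (my i * mclass (\<mu> - Poly_Mapping.single (VX i) 2))"
      unfolding split[OF 2] mclass_single_power[of "VX i" 2] mclass_var by (simp only: mult.assoc)
    then show ?thesis by (rule that(1))
  next
    case 3
    then show ?thesis using that(2) mclass_mexp mexp_eqI[OF fin 3] by metis
  qed
qed

lemma motcoh_induct [case_names zero add mclass]:
  assumes "Q 0" and add: "\<And>u v. Q u \<Longrightarrow> Q v \<Longrightarrow> Q (u + v)" and mclass: "\<And>\<mu>. Q (mclass \<mu>)"
  shows "Q u"
proof -
  obtain p where u: "u = abs_motcoh p" by (metis Quotient3_abs_rep Quotient3_motcoh)
  have "Q (abs_motcoh p)"
  proof (induction p rule: update_induct)
    case const
    then show ?case using assms(1) by (simp add: zero_motcoh_def)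
  next
    case (update p \<mu> b)
    \<comment> \<open>The updated coefficient is nonzero, hence 1, and the key was absent from
      \<open>p\<close>, so the update adds one monomial.\<close>
    have "Poly_Mapping.update \<mu> b p = Poly_Mapping.single \<mu> 1 + p"
      using update by (intro poly_mapping_eqI)
        (auto simp: lookup_update lookup_add lookup_single when_def in_keys_iff)
    then have "abs_motcoh (Poly_Mapping.update \<mu> b p) = mclass \<mu> + abs_motcoh p"
      by (simp add: mclass_def plus_motcoh.abs_eq)
    then show ?case using add mclass update by simp
  qed
  then show ?thesis using u by simp
qed

lemma motcoh_mmon_induct [consumes 1, case_names zero add mtau mmon]:
  fixes u :: "'n motcoh"
  assumes fin: "finite (UNIV :: 'n set)"
    and "Q 0" and "\<And>u v. Q u \<Longrightarrow> Q v \<Longrightarrow> Q (u + v)"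
    and tau: "\<And>u. Q (mtau * u)" and mmon: "\<And>S m. Q (mmon S m)"
  shows "Q u"
proof (induction u rule: motcoh_induct)
  case (mclass \<mu>)
  show ?case by (rule mclass_cases[OF fin, of \<mu>]) (simp_all add: tau mmon)
qed fact+

text \<open>The monomials without \<tau> and with x-exponents at most 1 are closed under divisors,
  and neither x_i^2 nor \<tau> y_i is among them. So no multiple of a relation involves such a
  monomial.\<close>

lemma rel_ideal_lookup:
  assumes "p \<in> rel_ideal" and "Poly_Mapping.lookup \<mu> VTau = 0"
    and "\<And>i. Poly_Mapping.lookup \<mu> (VX i) \<le> 1"
  shows "Poly_Mapping.lookup p \<mu> = 0"
proof -
  define R where "R = {\<mu> :: 'a mvar \<Rightarrow>\<^sub>0 nat. Poly_Mapping.lookup \<mu> VTau = 0 \<and> (\<forall>i. Poly_Mapping.lookup \<mu> (VX i) \<le> 1)}"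
  define T where "T = {p :: 'a mpoly2. \<forall>\<mu>\<in>R. Poly_Mapping.lookup p \<mu> = 0}"
  have R_add: "\<nu> \<in> R" if "\<kappa> + \<nu> \<in> R" for \<kappa> \<nu>
    using that by (auto simp: R_def lookup_add dest: spec intro: add_leD2)
  have T_mult: "c * p \<in> T" if "p \<in> T" for c p
    unfolding T_def
  proof safe
    fix \<mu> assume "\<mu> \<in> R"
    then have "(Poly_Mapping.lookup p \<nu> when \<mu> = \<kappa> + \<nu>) = 0" for \<kappa> \<nu>
      using R_add that unfolding T_def when_def by auto
    then show "Poly_Mapping.lookup (c * p) \<mu> = 0" unfolding lookup_mult by simp
  qed
  have "module.subspace (*) T"
    unfolding module.subspace_def[OF module_times]
    using T_mult by (auto simp: T_def lookup_add)
  moreover have "var (VX i) ^ 2 + var VTau * var (VY i) \<in> T" for i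
  proof -
    have "var (VX i) ^ 2 = Poly_Mapping.single (Poly_Mapping.single (VX i) 2) 1"
      by (simp add: var_def power2_eq_square mult_single numeral_2_eq_2 flip: single_add)
    moreover have "var VTau * var (VY i) = Poly_Mapping.single
        (Poly_Mapping.single VTau 1 + Poly_Mapping.single (VY i) 1) 1"
      by (simp add: var_def mult_single)
    moreover have "Poly_Mapping.single (VX i) 2 \<notin> R"
      by (auto simp: R_def lookup_single intro!: exI[of _ i])
    moreover have "Poly_Mapping.single VTau 1 + Poly_Mapping.single (VY i) 1 \<notin> R"
      by (auto simp: R_def lookup_single lookup_add)
    ultimately show ?thesis
      by (auto simp: T_def lookup_add lookup_single when_def)
  qed
  ultimately have "rel_ideal \<subseteq> T"
    unfolding rel_ideal_def by (intro module.span_minimal[OF module_times]) auto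
  then show ?thesis using assms unfolding T_def R_def by blast
qed

section \<open>The linear form on the quotient ring\<close>

definition zorbit :: "nat \<Rightarrow> ('n mvar \<Rightarrow>\<^sub>0 nat) set" where
  "zorbit k = {\<mu>. Poly_Mapping.lookup \<mu> VTau = 0 \<and> (\<forall>i. Poly_Mapping.lookup \<mu> (VX i) \<le> 1) \<and>
    zexp k {i. Poly_Mapping.lookup \<mu> (VX i) = 1} (\<lambda>i. Poly_Mapping.lookup \<mu> (VY i))}"

lift_definition zdual :: "nat \<Rightarrow> 'n motcoh \<Rightarrow> bit"
  is "\<lambda>k p. \<Sum>\<mu>\<in>zorbit k. Poly_Mapping.lookup p \<mu>"
proof -
  fix k :: nat and p q :: "'n mpoly2"
  assume "rel_cong p q"
  then have "Poly_Mapping.lookup (p - q) \<mu> = 0" if "\<mu> \<in> zorbit k" for \<mu>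
    using that unfolding rel_cong_def zorbit_def by (intro rel_ideal_lookup) auto
  then have "Poly_Mapping.lookup p \<mu> = Poly_Mapping.lookup q \<mu>" if "\<mu> \<in> zorbit k" for \<mu>
    using that by (metis lookup_minus eq_iff_diff_eq_0)
  then show "(\<Sum>\<mu>\<in>zorbit k. Poly_Mapping.lookup p \<mu>) = (\<Sum>\<mu>\<in>zorbit k. Poly_Mapping.lookup q \<mu>)"
    by (rule sum.cong[OF refl])
qed

text \<open>The sum defining \<open>zdual\<close> would take the default value 0 over an infinite
  set. Here the index type is finite and every y-exponent is at most 2^k.\<close>

lemma finite_zorbit:
  assumes fin: "finite (UNIV :: 'n set)"
  shows "finite (zorbit k :: ('n mvar \<Rightarrow>\<^sub>0 nat) set)"
proof -
  have "zexp k S m \<Longrightarrow> m i \<le> 2 ^ k" for S and m :: "'n \<Rightarrow> nat" and i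
  proof -
    assume "zexp k S m"
    then have "(\<exists>c. m i + c = 2 ^ k)" unfolding zexp_def by (metis add.assoc)
    then show "m i \<le> 2 ^ k" by (metis le_add1)
  qed
  then have bound: "m \<in> (\<Pi>\<^sub>E i\<in>UNIV. {..2 ^ k})" if "zexp k S m" for S and m :: "'n \<Rightarrow> nat"
    using that by (auto simp: PiE_iff)
  have "zorbit k \<subseteq> (\<lambda>(S, m). mexp S m) ` (UNIV \<times> (\<Pi>\<^sub>E i\<in>(UNIV :: 'n set). {..2 ^ k}))"
  proof
    fix \<mu> :: "'n mvar \<Rightarrow>\<^sub>0 nat" assume \<mu>: "\<mu> \<in> zorbit k"
    then have "\<mu> = mexp {i. Poly_Mapping.lookup \<mu> (VX i) = 1} (\<lambda>i. Poly_Mapping.lookup \<mu> (VY i))"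
      unfolding zorbit_def by (intro mexp_eqI[OF fin]) auto
    moreover have "(\<lambda>i. Poly_Mapping.lookup \<mu> (VY i)) \<in> (\<Pi>\<^sub>E i\<in>UNIV. {..2 ^ k})"
      using \<mu> bound unfolding zorbit_def by blast
    ultimately show "\<mu> \<in> (\<lambda>(S, m). mexp S m) ` (UNIV \<times> (\<Pi>\<^sub>E i\<in>(UNIV :: 'n set). {..2 ^ k}))"
      by (intro image_eqI[where x = "(_, _)"]) auto
  qed
  moreover have "finite (UNIV \<times> (\<Pi>\<^sub>E i\<in>(UNIV :: 'n set). {..2 ^ k::nat}) :: ('n set \<times> _) set)"
    using fin by (intro finite_cartesian_product finite_PiE) (auto simp: Finite_Set.finite_set)
  ultimately show ?thesis by (rule finite_subset[OF _ finite_imageI])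
qed

lemma zdual_zero: "zdual k 0 = 0"
  by transfer simp

lemma zdual_add: "zdual k (u + v) = zdual k u + zdual k v"
  by transfer (rule trans[OF sum.cong[OF refl lookup_add] sum.distrib])

lemma zdual_sum: "zdual k (\<Sum>i\<in>A. f i) = (\<Sum>i\<in>A. zdual k (f i))"
  by (induction A rule: infinite_finite_induct) (simp_all add: zdual_zero zdual_add)

lemma zdual_diff: "zdual k (u - v) = zdual k u - zdual k v"
  using zdual_add[of k "u - v" v] by (simp only: diff_add_cancel eq_diff_eq)

lemma zdual_mscale: "zdual k (mscale c u) = c * zdual k u"
  by (cases c) (simp_all add: mscale_def zdual_zero)

lemma zdual_of_nat_mult: "zdual k (of_nat c * u) = of_nat c * zdual k u"
  by (induction c) (simp_all add: zdual_zero zdual_add distrib_right)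

lemma zdual_mclass:
  fixes \<mu> :: "'n mvar \<Rightarrow>\<^sub>0 nat"
  assumes "finite (UNIV :: 'n set)"
  shows "zdual k (mclass \<mu>) = of_bool (\<mu> \<in> zorbit k)"
  using finite_zorbit[OF assms, of k]
  by (simp add: mclass_def zdual.abs_eq lookup_single when_def sum.delta)

lemma zdual_mmon:
  fixes m :: "'n \<Rightarrow> nat"
  assumes "finite (UNIV :: 'n set)"
  shows "zdual k (mmon S m) = of_bool (zexp k S m)"
  by (simp add: zdual_mclass[OF assms] zorbit_def lookup_mexp[OF assms] flip: mclass_mexp)

lemma zdual_mtau_mult:
  fixes u :: "'n motcoh"
  assumes fin: "finite (UNIV :: 'n set)"
  shows "zdual k (mtau * u) = 0"
proof (induction u rule: motcoh_induct)
  case (mclass \<mu>)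
  have "mtau * mclass \<mu> = mclass (Poly_Mapping.single VTau 1 + \<mu>)"
    by (simp only: mclass_add mclass_var)
  then show ?case by (simp add: zdual_mclass[OF fin] zorbit_def lookup_add)
qed (simp_all add: zdual_zero zdual_add distrib_left)

section \<open>The operations on monomials\<close>

context motivic_steenrod_action
begin

lemma act_zero_left: "act 0 u = 0"
  using act_add_left[of 0 0 u] by simp

lemma act_zero_right: "act a 0 = 0"
  using act_add_right[of a 0 0] by simp

lemma act_diff_left: "act (a - b) u = act a u - act b u"
  using act_add_left[of "a - b" b u] by simp

lemma act_sum_right: "act a (\<Sum>i\<in>A. f i) = (\<Sum>i\<in>A. act a (f i))"
  by (induction A rule: infinite_finite_induct) (simp_all add: act_zero_right act_add_right)

lemma Q0_one: "act Q0 1 = 0"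
  using Q0_cartan[of 1 1] by simp

text \<open>In the Cartan formula for 1 * 1 the inner terms and the \<tau>-terms vanish by
  induction, while the two outer terms are both \<wp>^r(1) and cancel modulo 2.\<close>

lemma P_one_right:
  assumes "1 \<le> r"
  shows "act (P r) 1 = 0"
  using assms
proof (induction r rule: less_induct)
  case (less r)
  have P_lt: "act (P s) 1 = (if s = 0 then 1 else 0)" if "s < r" for s
    using less.IH[OF that] by (simp add: P_zero act_one)
  have "act Q0 (act (P s) 1) = 0" if "s < r" for s
    using P_lt[OF that] by (simp add: Q0_one act_zero_right)
  then have "act (P r) 1 = (\<Sum>s\<in>{0..r}. act (P (r - s)) 1 * act (P s) 1)"
    using P_cartan[of r 1 1] by simp
  also have "\<dots> = (\<Sum>s\<in>{0, r}. act (P (r - s)) 1 * act (P s) 1)"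
    using P_lt by (intro sum.mono_neutral_right) auto
  also have "\<dots> = act (P r) 1 * act (P 0) 1 + act (P 0) 1 * act (P r) 1"
    using less.prems by simp
  also have "\<dots> = 0"
    unfolding P_zero act_one mult_1_left mult_1_right by (rule motcoh_two)
  finally show ?case .
qed

lemma Q0_power:
  assumes "act Q0 u = 0"
  shows "act Q0 (u ^ m) = 0"
  using assms by (induction m) (simp_all add: Q0_one Q0_cartan)

lemma Q0_my_prod: "act Q0 (\<Prod>i\<in>I. my i ^ m i) = 0"
  by (induction I rule: infinite_finite_induct)
    (simp_all add: Q0_one Q0_cartan Q0_power Q0_y)

lemma my_times_prod:
  assumes "finite (UNIV :: 'n set)"
  shows "my s * (\<Prod>i\<in>UNIV. my i ^ m i) = (\<Prod>i\<in>(UNIV :: 'n set). my i ^ (m(s := m s + 1)) i)"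
proof -
  have "(\<Prod>i\<in>UNIV - {s}. my i ^ (m(s := m s + 1)) i) = (\<Prod>i\<in>UNIV - {s}. my i ^ m i)"
    by (intro prod.cong) auto
  then show ?thesis
    using prod.remove[OF assms UNIV_I, of "\<lambda>i. my i ^ m i" s]
      prod.remove[OF assms UNIV_I, of "\<lambda>i. my i ^ (m(s := m s + 1)) i" s]
    by (simp add: mult.assoc)
qed

lemma Q0_mx_prod:
  assumes "finite S"
  shows "act Q0 (\<Prod>i\<in>S. mx i) = (\<Sum>s\<in>S. my s * (\<Prod>i\<in>S - {s}. mx i))"
  using assms
proof (induction S rule: finite_induct)
  case empty
  then show ?case by (simp add: Q0_one)
next
  case (insert j S)
  have "(\<Prod>i\<in>insert j S - {s}. mx i) = mx j * (\<Prod>i\<in>S - {s}. mx i)" if "s \<in> S" for s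
  proof -
    have "insert j S - {s} = insert j (S - {s})" using that insert by auto
    then show ?thesis using insert by simp
  qed
  then have "(\<Sum>s\<in>S. my s * (\<Prod>i\<in>insert j S - {s}. mx i)) =
      mx j * (\<Sum>s\<in>S. my s * (\<Prod>i\<in>S - {s}. mx i))"
    by (simp add: sum_distrib_left mult.left_commute)
  moreover have "insert j S - {j} = S" using insert by auto
  ultimately show ?case
    using insert by (simp add: Q0_cartan Q0_x)
qed

lemma Q0_mmon:
  assumes fin: "finite (UNIV :: 'n set)"
  shows "act Q0 (mmon S m) = (\<Sum>s\<in>S. mmon (S - {s}) (m(s := m s + 1)))"
proof -
  have "act Q0 (mmon S m) = (\<Sum>s\<in>S. my s * (\<Prod>i\<in>S - {s}. mx i)) * (\<Prod>i\<in>UNIV. my i ^ m i)"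
    unfolding mmon_def Q0_cartan Q0_my_prod
    using Q0_mx_prod[OF finite_subset[OF subset_UNIV fin]] by simp
  also have "\<dots> = (\<Sum>s\<in>S. (\<Prod>i\<in>S - {s}. mx i) * (my s * (\<Prod>i\<in>UNIV. my i ^ m i)))"
    by (simp add: sum_distrib_left mult_ac)
  finally show ?thesis unfolding my_times_prod[OF fin] mmon_def .
qed

lemma Q0_mtau_mult: "act Q0 (mtau * u) = mtau * act Q0 u"
  by (simp add: Q0_cartan Q0_tau)

text \<open>The operations preserve the multiples of \<tau>, on which \<open>zdual\<close> vanishes,
  so computations modulo \<tau> suffice.\<close>

lemma P_mtau_mult: "\<exists>v. act (P r) (mtau * u) = mtau * v"
proof -
  have "(\<Sum>s\<in>{0..r}. act (P (r - s)) mtau * act (P s) u) =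
      (\<Sum>s\<in>{r}. act (P (r - s)) mtau * act (P s) u)"
  proof (rule sum.mono_neutral_right)
    show "\<forall>s\<in>{0..r} - {r}. act (P (r - s)) mtau * act (P s) u = 0"
    proof
      fix s assume "s \<in> {0..r} - {r}"
      then have "1 \<le> r - s" by auto
      from P_tau[OF this] show "act (P (r - s)) mtau * act (P s) u = 0" by simp
    qed
  qed auto
  then show ?thesis
    unfolding P_cartan by (auto simp: P_zero act_one simp flip: distrib_left)
qed

text \<open>Since \<wp>^a kills x_i for positive a, \<wp>^r commutes with multiplication by x_i up
  to the Q_0-part of the Cartan formula, which carries the factor \<tau>.\<close>

lemma P_mx_mult: "\<exists>v. act (P r) (mx i * u) = mx i * act (P r) u + mtau * v"
proof -
  have "(\<Sum>s\<in>{0..r}. act (P (r - s)) (mx i) * act (P s) u) =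
      (\<Sum>s\<in>{r}. act (P (r - s)) (mx i) * act (P s) u)"
  proof (rule sum.mono_neutral_right)
    show "\<forall>s\<in>{0..r} - {r}. act (P (r - s)) (mx i) * act (P s) u = 0"
    proof
      fix s assume "s \<in> {0..r} - {r}"
      then have "1 \<le> r - s" by auto
      from P_x[OF this] show "act (P (r - s)) (mx i) * act (P s) u = 0" by simp
    qed
  qed auto
  then show ?thesis
    unfolding P_cartan by (auto simp: P_zero act_one)
qed

lemma P_mx_prod_mult:
  assumes "finite S"
  shows "\<exists>v. act (P r) ((\<Prod>i\<in>S. mx i) * u) = (\<Prod>i\<in>S. mx i) * act (P r) u + mtau * v"
  using assms
proof (induction S rule: finite_induct)
  case empty
  show ?case by (rule exI[of _ 0]) simp
next
  case (insert j S)
  obtain v where v: "act (P r) ((\<Prod>i\<in>S. mx i) * u) = (\<Prod>i\<in>S. mx i) * act (P r) u + mtau * v"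
    using insert by blast
  obtain w where "act (P r) (mx j * ((\<Prod>i\<in>S. mx i) * u)) =
      mx j * act (P r) ((\<Prod>i\<in>S. mx i) * u) + mtau * w"
    using P_mx_mult by blast
  then have "act (P r) ((\<Prod>i\<in>insert j S. mx i) * u) =
      (\<Prod>i\<in>insert j S. mx i) * act (P r) u + mtau * (mx j * v + w)"
    unfolding v using insert by (simp add: algebra_simps)
  then show ?case by blast
qed

section \<open>The total power operation and its values on monomials in the y_i\<close>

definition total_P :: "'n motcoh \<Rightarrow> 'n motcoh fps" where
  "total_P u = Abs_fps (\<lambda>r. act (P r) u)"

text \<open>The Cartan formula has no \<open>\<tau>\<close>-term when one factor is in the common kernel of the
  \<open>Q\<^sub>0 \<wp>\<^sup>s\<close>.\<close>

definition Q0_P_kernel :: "'n motcoh set" where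
  "Q0_P_kernel = {u. \<forall>s. act Q0 (act (P s) u) = 0}"

lemma P_mult_kernel:
  assumes "v \<in> Q0_P_kernel"
  shows "act (P r) (u * v) = (\<Sum>s\<in>{0..r}. act (P (r - s)) u * act (P s) v)"
  using assms unfolding P_cartan Q0_P_kernel_def by simp

lemma total_P_mult:
  assumes "v \<in> Q0_P_kernel"
  shows "total_P (u * v) = total_P u * total_P v"
proof -
  \<comment> \<open>The factors are exchanged because the Cartan formula puts the summation index on
    the second factor, the product of power series on the first.\<close>
  have "total_P (u * v) = total_P v * total_P u"
    by (rule fps_ext) (auto simp: total_P_def fps_mult_nth P_mult_kernel[OF assms]
        intro!: sum.cong mult.commute)
  then show ?thesis by (simp add: mult.commute)
qed

lemma one_in_kernel: "1 \<in> Q0_P_kernel"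
  unfolding Q0_P_kernel_def
proof safe
  fix s show "act Q0 (act (P s) 1) = 0"
    using P_one_right[of s] by (cases s) (simp_all add: P_zero act_one Q0_one act_zero_right)
qed

lemma total_P_one: "total_P 1 = 1"
proof (rule fps_ext)
  fix r show "fps_nth (total_P 1) r = fps_nth 1 r"
    using P_one_right[of r] by (cases r) (simp_all add: total_P_def P_zero act_one)
qed

lemma P_my: "act (P r) (my i) = (if r = 0 then my i else if r = 1 then my i ^ 2 else 0)"
  using P_y[of r i] by (auto simp: P_zero act_one P_one_y[unfolded One_nat_def] P_one_y)

lemma my_in_kernel: "my i \<in> Q0_P_kernel"
  unfolding Q0_P_kernel_def by (auto simp: P_my Q0_y Q0_power act_zero_right)

lemma total_P_my: "total_P (my i) = fps_const (my i ^ 2) * fps_X + fps_const (my i)"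
  by (rule fps_ext) (simp add: total_P_def P_my)

lemma mult_in_kernel:
  assumes "u \<in> Q0_P_kernel" and "v \<in> Q0_P_kernel"
  shows "u * v \<in> Q0_P_kernel"
  using assms unfolding Q0_P_kernel_def
  by (auto simp: P_mult_kernel[OF assms(2)] act_sum_right Q0_cartan)

lemma power_in_kernel: "u \<in> Q0_P_kernel \<Longrightarrow> u ^ m \<in> Q0_P_kernel"
  by (induction m) (simp_all add: one_in_kernel mult_in_kernel)

lemma prod_in_kernel: "(\<And>i. i \<in> I \<Longrightarrow> f i \<in> Q0_P_kernel) \<Longrightarrow> (\<Prod>i\<in>I. f i) \<in> Q0_P_kernel"
  by (induction I rule: infinite_finite_induct) (simp_all add: one_in_kernel mult_in_kernel)

lemma total_P_power: "u \<in> Q0_P_kernel \<Longrightarrow> total_P (u ^ m) = total_P u ^ m"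
  by (induction m) (simp_all add: total_P_one total_P_mult power_in_kernel)

lemma total_P_prod:
  "(\<And>i. i \<in> I \<Longrightarrow> f i \<in> Q0_P_kernel) \<Longrightarrow> total_P (\<Prod>i\<in>I. f i) = (\<Prod>i\<in>I. total_P (f i))"
  by (induction I rule: infinite_finite_induct)
    (simp_all add: total_P_one total_P_mult prod_in_kernel)

text \<open>By multiplicativity the total operation sends the monomial to the product of the (y_i +
  y_i^2 t)^(m_i). Here \<alpha> counts, for each i, the factors from which y_i^2 t is chosen, and
  the coefficient of t^r is read off.\<close>

lemma P_my_prod:
  assumes fin: "finite (UNIV :: 'n set)"
  shows "act (P r) (\<Prod>i\<in>UNIV. my i ^ m i) =
    (\<Sum>\<alpha> | \<alpha> \<in> (\<Pi>\<^sub>E i\<in>(UNIV :: 'n set). {..m i}) \<and> sum \<alpha> UNIV = r.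
      of_nat (\<Prod>i\<in>UNIV. m i choose \<alpha> i) * (\<Prod>i\<in>UNIV. my i ^ (m i + \<alpha> i)))"
proof -
  let ?A = "\<Pi>\<^sub>E i\<in>(UNIV :: 'n set). {..m i}"
  have finA: "finite ?A" using fin by (intro finite_PiE) auto
  have summand: "of_nat (m i choose a) * (fps_const (my i ^ 2) * fps_X) ^ a * fps_const (my i) ^ (m i - a)
      = fps_const (of_nat (m i choose a) * my i ^ (m i + a)) * fps_X ^ a"
    if "a \<le> m i" for i :: 'n and a
  proof -
    have "(my i ^ 2) ^ a * my i ^ (m i - a) = my i ^ (m i + a)"
      using that by (simp add: add.commute flip: power_mult power_add)
    then have "fps_const (of_nat (m i choose a) * my i ^ (m i + a)) =
        fps_const (of_nat (m i choose a)) * (fps_const (my i ^ 2) ^ a * fps_const (my i) ^ (m i - a))"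
      by (simp add: fps_const_power)
    then show ?thesis
      by (simp add: fps_of_nat power_mult_distrib mult_ac)
  qed
  have "total_P (\<Prod>i\<in>UNIV. my i ^ m i) = (\<Prod>i\<in>UNIV. total_P (my i) ^ m i)"
    by (simp add: total_P_prod power_in_kernel my_in_kernel total_P_power)
  also have "\<dots> = (\<Prod>i\<in>UNIV. \<Sum>a\<le>m i. fps_const (of_nat (m i choose a) * my i ^ (m i + a)) * fps_X ^ a)"
    unfolding total_P_my binomial_ring using summand by (intro prod.cong sum.cong) auto
  also have "\<dots> = (\<Sum>\<alpha>\<in>?A. \<Prod>i\<in>UNIV. fps_const (of_nat (m i choose \<alpha> i) * my i ^ (m i + \<alpha> i)) * fps_X ^ \<alpha> i)"
    using fin by (intro prod_sum_PiE) auto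
  also have "\<dots> = (\<Sum>\<alpha>\<in>?A. fps_const (of_nat (\<Prod>i\<in>UNIV. m i choose \<alpha> i) *
      (\<Prod>i\<in>UNIV. my i ^ (m i + \<alpha> i))) * fps_X ^ sum \<alpha> UNIV)"
  proof (rule sum.cong[OF refl])
    fix \<alpha> :: "'n \<Rightarrow> nat"
    have const: "(\<Prod>i\<in>I. fps_const (f i)) = fps_const (\<Prod>i\<in>I. f i)" for I and f :: "'n \<Rightarrow> 'n motcoh"
      by (induction I rule: infinite_finite_induct) simp_all
    show "(\<Prod>i\<in>UNIV. fps_const (of_nat (m i choose \<alpha> i) * my i ^ (m i + \<alpha> i)) * fps_X ^ \<alpha> i) =
        fps_const (of_nat (\<Prod>i\<in>UNIV. m i choose \<alpha> i) * (\<Prod>i\<in>UNIV. my i ^ (m i + \<alpha> i))) * fps_X ^ sum \<alpha> UNIV"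
      by (simp only: prod.distrib const of_nat_prod power_sum)
  qed
  finally have "act (P r) (\<Prod>i\<in>UNIV. my i ^ m i) = (\<Sum>\<alpha>\<in>?A. if sum \<alpha> UNIV = r then
      of_nat (\<Prod>i\<in>UNIV. m i choose \<alpha> i) * (\<Prod>i\<in>UNIV. my i ^ (m i + \<alpha> i)) else 0)"
    (is "_ = (\<Sum>\<alpha>\<in>?A. if _ then ?h \<alpha> else 0)")
  proof -
    assume eq: "total_P (\<Prod>i\<in>UNIV. my i ^ m i) = (\<Sum>\<alpha>\<in>?A. fps_const (?h \<alpha>) * fps_X ^ sum \<alpha> UNIV)"
    have "act (P r) (\<Prod>i\<in>UNIV. my i ^ m i) = fps_nth (total_P (\<Prod>i\<in>UNIV. my i ^ m i)) r"
      by (simp add: total_P_def)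
    also have "\<dots> = (\<Sum>\<alpha>\<in>?A. fps_nth (fps_const (?h \<alpha>) * fps_X ^ sum \<alpha> UNIV) r)"
      unfolding eq fps_sum_nth ..
    also have "\<dots> = (\<Sum>\<alpha>\<in>?A. if sum \<alpha> UNIV = r then ?h \<alpha> else 0)"
      by (intro sum.cong refl) (simp add: fps_X_power_nth del: of_nat_prod)
    finally show ?thesis .
  qed
  also have "\<dots> = (\<Sum>\<alpha> | \<alpha> \<in> ?A \<and> sum \<alpha> UNIV = r. ?h \<alpha>)"
    using sum.inter_filter[OF finA, of ?h "\<lambda>\<alpha>. sum \<alpha> UNIV = r"] by simp
  finally show ?thesis .
qed

section \<open>Vanishing of the linear form on the image of the Steenrod algebra\<close>

lemma zdual_Q0:
  assumes fin: "finite (UNIV :: 'n set)" and "1 \<le> k"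
  shows "zdual k (act Q0 u) = 0"
  using fin
proof (induction u rule: motcoh_mmon_induct)
  case (mmon S m)
  have "finite S" using finite_subset[OF subset_UNIV fin] .
  then show ?case
    using sum_zexp_remove[OF \<open>1 \<le> k\<close>, of S m]
    by (simp add: Q0_mmon[OF fin] zdual_sum zdual_mmon[OF fin])
qed (simp_all add: act_zero_right zdual_zero act_add_right zdual_add Q0_mtau_mult zdual_mtau_mult[OF fin])

lemma zdual_P:
  assumes fin: "finite (UNIV :: 'n set)" and "1 \<le> r"
  shows "zdual k (act (P r) u) = 0"
  using fin
proof (induction u rule: motcoh_mmon_induct)
  case (mtau u)
  obtain v where "act (P r) (mtau * u) = mtau * v" using P_mtau_mult by blast
  then show ?case by (simp add: zdual_mtau_mult[OF fin])
next
  case (mmon S m)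
  let ?A = "{\<alpha>. \<alpha> \<in> (\<Pi>\<^sub>E i\<in>UNIV. {..m i}) \<and> sum \<alpha> UNIV = r}"
  have "finite S" using finite_subset[OF subset_UNIV fin] .
  then obtain v where "act (P r) (mmon S m) =
      (\<Prod>i\<in>S. mx i) * act (P r) (\<Prod>i\<in>UNIV. my i ^ m i) + mtau * v"
    unfolding mmon_def using P_mx_prod_mult by blast
  also have "(\<Prod>i\<in>S. mx i) * act (P r) (\<Prod>i\<in>UNIV. my i ^ m i) =
      (\<Sum>\<alpha>\<in>?A. of_nat (\<Prod>i\<in>UNIV. m i choose \<alpha> i) * mmon S (\<lambda>i. m i + \<alpha> i))"
    unfolding P_my_prod[OF fin] sum_distrib_left mmon_def
    by (intro sum.cong refl) (simp only: mult_ac)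
  finally show ?case
    using sum_choose_zexp[OF fin \<open>1 \<le> r\<close>, of m k S]
    by (simp add: zdual_add zdual_mtau_mult[OF fin] zdual_sum zdual_of_nat_mult zdual_mmon[OF fin]
        del: of_nat_prod)
qed (simp_all add: act_zero_right zdual_zero act_add_right zdual_add)

lemma zdual_steenrod_plus_image:
  assumes fin: "finite (UNIV :: 'n set)" and "1 \<le> k" and "u \<in> steenrod_plus_image gr act"
  shows "zdual k u = 0"
proof -
  \<comment> \<open>This is a right ideal: in \<open>act (a * b) u\<close> the factor
    \<open>b\<close> is absorbed into the arbitrary element \<open>u\<close>. So only the generators
    need to be checked.\<close>
  define T where "T = {a. \<forall>u. zdual k (act a u) = 0}"
  have "steenrod_plus gr \<subseteq> T"
  proof (rule steenrod_plus_subset_right_ideal)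
    show "a - b \<in> T" if "a \<in> T" "b \<in> T" for a b
      using that by (simp add: T_def act_diff_left zdual_diff)
  qed (simp_all add: T_def act_zero_left zdual_zero act_mult act_tau zdual_mtau_mult[OF fin]
      zdual_Q0[OF fin \<open>1 \<le> k\<close>] zdual_P[OF fin])
  moreover have module: "module (mscale :: bit \<Rightarrow> 'n motcoh \<Rightarrow> _)"
    using vector_space_mscale by (simp add: vector_space_def module_def)
  have "module.subspace mscale {u :: 'n motcoh. zdual k u = 0}"
    by (simp add: module.subspace_def[OF module] zdual_zero zdual_add zdual_mscale)
  ultimately have "steenrod_plus_image gr act \<subseteq> {u. zdual k u = 0}"
    unfolding steenrod_plus_image_def T_def
    using module by (intro module.span_minimal) auto
  then show ?thesis using assms(3) by blast
qed

end

section \<open>The monomial z_k and the conclusion\<close>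

lemma zmon_eq_mmon:
  fixes e :: "nat \<Rightarrow> 'n"
  assumes e: "bij_betw e {1..n} UNIV" and "k < n"
  obtains m where "zmon e n k = mmon (e ` {1..k}) m" and "zexp k (e ` {1..k}) m"
proof -
  define m where "m = (\<lambda>j. 2 ^ k - (let i = inv_into {1..n} e j in if i \<le> k then 2 ^ (k - i) else 0) - (1::nat))"
  have inj: "inj_on e {1..n}" using e by (simp add: bij_betw_def)
  have m: "m (e i) = (if i \<le> k then 2 ^ k - 2 ^ (k - i) - 1 else 2 ^ k - 1)" if "i \<in> {1..n}" for i
    using inv_into_f_f[OF inj that] by (simp add: m_def)
  have inj_k: "inj_on e {1..k}" using \<open>k < n\<close> by (intro inj_on_subset[OF inj]) auto
  have "(\<Prod>j\<in>UNIV. my j ^ m j) = (\<Prod>i\<in>{1..n}. my (e i) ^ m (e i))"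
    using prod.reindex_bij_betw[OF e, of "\<lambda>j. my j ^ m j"] by simp
  also have "{1..n} = {1..k} \<union> {k + 1..n}" using \<open>k < n\<close> by auto
  also have "(\<Prod>i\<in>{1..k} \<union> {k + 1..n}. my (e i) ^ m (e i)) =
      (\<Prod>i\<in>{1..k}. my (e i) ^ m (e i)) * (\<Prod>i\<in>{k + 1..n}. my (e i) ^ m (e i))"
    by (intro prod.union_disjoint) auto
  also have "(\<Prod>i\<in>{1..k}. my (e i) ^ m (e i)) = (\<Prod>i\<in>{1..k}. my (e i) ^ (2 ^ k - 2 ^ (k - i) - 1))"
    using m \<open>k < n\<close> by (intro prod.cong) auto
  also have "(\<Prod>i\<in>{k + 1..n}. my (e i) ^ m (e i)) = (\<Prod>i\<in>{k + 1..n}. my (e i) ^ (2 ^ k - 1))"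
    using m by (intro prod.cong) auto
  finally have "zmon e n k = mmon (e ` {1..k}) m"
    unfolding zmon_def mmon_def prod.reindex[OF inj_k] by (simp add: mult.assoc)
  moreover have "zexp k (e ` {1..k}) m"
    unfolding zexp_def
  proof (intro exI conjI ballI allI impI)
    \<comment> \<open>The index \<open>e i\<close> with i \<le> k has y-exponent 2^k - 2^(k-i) - 1,
      so its power of 2 is the one of exponent k - i.\<close>
    let ?\<sigma> = "\<lambda>j. k - inv_into {1..n} e j"
    have inv: "inv_into {1..n} e (e i) = i" if "i \<in> {1..k}" for i
      using inv_into_f_f[OF inj, of i] that \<open>k < n\<close> by simp
    have rev: "bij_betw (\<lambda>i. k - i) {1..k} {..<k}"
      by (rule bij_betw_byWitness[where f' = "\<lambda>i. k - i"]) auto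
    have "bij_betw (inv_into {1..n} e) (e ` {1..k}) {1..k}"
      by (rule bij_betw_byWitness[where f' = e]) (use inv in auto)
    from bij_betw_trans[OF this rev] show "bij_betw ?\<sigma> (e ` {1..k}) {..<k}"
      by (simp add: comp_def)
    fix j
    show "m j + 1 + 2 ^ ?\<sigma> j = 2 ^ k" if j: "j \<in> e ` {1..k}"
    proof -
      obtain i where i: "j = e i" "1 \<le> i" "i \<le> k" using j by auto
      \<comment> \<open>As i is at least 1, the subtractions of natural numbers in the exponent do
        not truncate.\<close>
      have "(2::nat) ^ (k - i) < 2 ^ k" using i by (intro power_strict_increasing) auto
      moreover have "m j = 2 ^ k - 2 ^ (k - i) - 1" using m[of i] i \<open>k < n\<close> by simp
      ultimately have "m j + 1 + 2 ^ (k - i) = 2 ^ k" by linarith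
      moreover have "inv_into {1..n} e j = i" using inv[of i] i by simp
      ultimately show ?thesis by (simp only:)
    qed
    show "m j + 1 = 2 ^ k" if "j \<notin> e ` {1..k}"
    proof -
      have "j \<in> e ` {1..n}" using e by (simp add: bij_betw_def)
      then obtain i where i: "j = e i" "i \<in> {1..n}" by (rule imageE)
      have "\<not> i \<le> k" using that i by auto
      then show ?thesis using m[of i] i by simp
    qed
  qed
  ultimately show thesis by (rule that)
qed

theorem proposition1p4:
  fixes k n :: nat
    and e :: "nat \<Rightarrow> 'n"
    and gr :: "int \<times> int \<Rightarrow> 'a::ring_1 set"
    and emb :: "bit poly \<Rightarrow> 'a" and Q0 :: 'a and P :: "nat \<Rightarrow> 'a"
    and act :: "'a \<Rightarrow> 'n motcoh \<Rightarrow> 'n motcoh"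
  assumes "1 \<le> k" and "k < n"
    and "bij_betw e {1..n} UNIV"
    and "motivic_steenrod_action gr emb Q0 P act"
  shows "zmon e n k \<notin> steenrod_plus_image gr act"
proof
  interpret motivic_steenrod_action gr emb Q0 P act by fact
  have fin: "finite (UNIV :: 'n set)"
    using bij_betw_finite[OF assms(3)] by simp
  obtain m where m: "zmon e n k = mmon (e ` {1..k}) m" "zexp k (e ` {1..k}) m"
    using zmon_eq_mmon[OF assms(3,2)] by blast
  assume "zmon e n k \<in> steenrod_plus_image gr act"
  then have "zdual k (zmon e n k) = 0"
    using zdual_steenrod_plus_image[OF fin \<open>1 \<le> k\<close>] by blast
  then show False using m zdual_mmon[OF fin] by simp
qed

end
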